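(* Let $p$ be a prime and let $G$ be a finite $p$-group of exponent $p^e$. Then \[ \lambda(\Gamma_G) = \begin{cases} 2(p^e - 1) & \text{if } G \text{ is cyclic}, \\ |G| + 1 & \text{if } p = 2 \text{ and } G \text{ is generalized quaternion}, \\ |G| & \text{otherwise}. \end{cases} \]
   Context: A finite group $G$ is a $p$-group ($p$ prime) if $|G| = p^n$ for some integer $n \geq 1$; its exponent is the maximum of the orders of its elements. The power graph $\Gamma_G$ of a finite group $G$ is the simple undirected graph with vertex set $G$ in which two distinct vertices $a, b$ are adjacent if and only if $a = b^n$ or $b = a^m$ for some positive integers $m, n$. For a finite simple graph $\Gamma$ with graph distance $d$, an $L(2,1)$-labelling is a function $f : V(\Gamma) \to \mathbb{Z}$ such that $|f(a) - f(b)| \geq 2$ whenever $d(a,b) = 1$, and $|f(a) - f(b)| \geq 1$ whenever $d(a,b) = 2$. Its span is $\mathrm{span}(f) = \max_{x \in V(\Gamma)} f(x) - \min_{x \in V(\Gamma)} f(x)$. The lambda number is $\lambda(\Gamma) = \min\{\mathrm{span}(f) : f \text{ is an } L(2,1)\text{-labelling of } \Gamma\}$. A generalized quaternion $2$-group is a group isomorphic to $\mathbb{Q}_{2^{k+1}} = \langle x, y : x^{2^k} = 1,\ x^{2^{k-1}} = y^2,\ y^{-1}xy = x^{-1} \rangle$ (of order $2^{k+1}$) for some integer $k \geq 2$. *)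

theory Defs
  imports
    "HOL-Algebra.Elementary_Groups"
    "HOL-Algebra.Multiplicative_Group"
    "HOL-Computational_Algebra.Primes"
    "Graph_Theory.Pair_Digraph"
    "Graph_Theory.Shortest_Path"
begin

section \<open>Groups\<close>

definition p_group :: "nat \<Rightarrow> ('a, 'b) monoid_scheme \<Rightarrow> bool" where
  "p_group p G \<longleftrightarrow> prime p \<and> group G \<and> (\<exists>n\<ge>1. order G = p ^ n)"

definition group_exponent :: "('a, 'b) monoid_scheme \<Rightarrow> nat" where
  "group_exponent G = Max (group.ord G ` carrier G)"

subsection \<open>Groups given by a presentation\<close>

text \<open>
  A word is a list of letters; \<open>(g, False)\<close> stands for the generator \<open>g\<close> and \<open>(g, True)\<close>
  for its inverse. A relation \<open>u = v\<close> is a pair of words. The presented group consists of the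
  words modulo the least congruence containing free cancellation and the given relations.
\<close>

type_synonym 'g word = "('g \<times> bool) list"

inductive_set pres_cong :: "('g word \<times> 'g word) set \<Rightarrow> ('g word \<times> 'g word) set"
  for R :: "('g word \<times> 'g word) set" where
  refl: "(u, u) \<in> pres_cong R"
| sym: "(u, v) \<in> pres_cong R \<Longrightarrow> (v, u) \<in> pres_cong R"
| trans: "(u, v) \<in> pres_cong R \<Longrightarrow> (v, w) \<in> pres_cong R \<Longrightarrow> (u, w) \<in> pres_cong R"
| append: "(u, u') \<in> pres_cong R \<Longrightarrow> (v, v') \<in> pres_cong R \<Longrightarrow> (u @ v, u' @ v') \<in> pres_cong R"
| cancel: "([(g, b), (g, \<not> b)], []) \<in> pres_cong R"
| rel: "(u, v) \<in> R \<Longrightarrow> (u, v) \<in> pres_cong R"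

definition presented_group :: "('g word \<times> 'g word) set \<Rightarrow> 'g word set monoid" where
  "presented_group R =
    \<lparr> carrier = UNIV // pres_cong R,
      monoid.mult = (\<lambda>A B. \<Union>a\<in>A. \<Union>b\<in>B. pres_cong R `` {a @ b}),
      one = pres_cong R `` {[]} \<rparr>"

lemma equiv_pres_cong: "equiv UNIV (pres_cong R)"
proof (rule equivI)
  show "refl (pres_cong R)" by (rule refl_onI) (rule pres_cong.refl)
  show "sym (pres_cong R)" by (rule symI) (rule pres_cong.sym)
  show "trans (pres_cong R)" by (rule transI) (rule pres_cong.trans)
qed simp

lemma pres_class_eq_iff: "pres_cong R `` {u} = pres_cong R `` {v} \<longleftrightarrow> (u, v) \<in> pres_cong R"
  using eq_equiv_class_iff[OF equiv_pres_cong] by simp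

lemma presented_group_mult:
  "monoid.mult (presented_group R) (pres_cong R `` {u}) (pres_cong R `` {v}) = pres_cong R `` {u @ v}"
proof -
  have "pres_cong R `` {a @ b} = pres_cong R `` {u @ v}"
    if "a \<in> pres_cong R `` {u}" "b \<in> pres_cong R `` {v}" for a b
    unfolding pres_class_eq_iff
    by (rule pres_cong.sym, rule pres_cong.append) (use that in simp_all)
  moreover have "u \<in> pres_cong R `` {u}" "v \<in> pres_cong R `` {v}"
    by (simp_all add: pres_cong.refl)
  ultimately show ?thesis
    unfolding presented_group_def monoid.simps by blast
qed

lemma presented_group_inverse_word:
  "(rev (map (\<lambda>(g, b). (g, \<not> b)) u) @ u, []) \<in> pres_cong R"
proof (induction u)
  case Nil
  show ?case by (simp add: pres_cong.refl)
next
  case (Cons x u)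
  obtain g b where x: "x = (g, b)" by force
  let ?w = "rev (map (\<lambda>(g, b). (g, \<not> b)) u)"
  have "([(g, \<not> b), (g, b)], []) \<in> pres_cong R"
    using pres_cong.cancel[of g "\<not> b" R] by simp
  then have "(?w @ [(g, \<not> b), (g, b)] @ u, ?w @ [] @ u) \<in> pres_cong R"
    by (intro pres_cong.append pres_cong.refl)
  then have "(?w @ [(g, \<not> b), (g, b)] @ u, []) \<in> pres_cong R"
    using Cons.IH by (simp only: append_Nil) (rule pres_cong.trans)
  then show ?case by (simp add: x)
qed

lemma group_presented_group: "group (presented_group R)"
proof (rule groupI)
  note car = presented_group_def quotient_def
  have one: "\<one>\<^bsub>presented_group R\<^esub> = pres_cong R `` {[]}"
    by (simp add: presented_group_def)
  have rep: "\<exists>u. A = pres_cong R `` {u}" if "A \<in> carrier (presented_group R)" for A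
    using that unfolding car by auto
  have mem: "pres_cong R `` {u} \<in> carrier (presented_group R)" for u
    unfolding car by auto
  show "\<one>\<^bsub>presented_group R\<^esub> \<in> carrier (presented_group R)"
    using mem one by simp
  fix A assume A: "A \<in> carrier (presented_group R)"
  then obtain u where u: "A = pres_cong R `` {u}" using rep by blast
  show "\<one>\<^bsub>presented_group R\<^esub> \<otimes>\<^bsub>presented_group R\<^esub> A = A"
    by (simp add: one u presented_group_mult)
  show "\<exists>B\<in>carrier (presented_group R). B \<otimes>\<^bsub>presented_group R\<^esub> A = \<one>\<^bsub>presented_group R\<^esub>"
  proof (rule bexI[OF _ mem])
    show "pres_cong R `` {rev (map (\<lambda>(g, b). (g, \<not> b)) u)} \<otimes>\<^bsub>presented_group R\<^esub> A
        = \<one>\<^bsub>presented_group R\<^esub>"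
      unfolding one u presented_group_mult pres_class_eq_iff
      by (rule presented_group_inverse_word)
  qed
  fix B assume "B \<in> carrier (presented_group R)"
  then obtain v where v: "B = pres_cong R `` {v}" using rep by blast
  show "A \<otimes>\<^bsub>presented_group R\<^esub> B \<in> carrier (presented_group R)"
    by (simp add: u v presented_group_mult mem)
  fix C assume "C \<in> carrier (presented_group R)"
  then obtain w where w: "C = pres_cong R `` {w}" using rep by blast
  show "A \<otimes>\<^bsub>presented_group R\<^esub> B \<otimes>\<^bsub>presented_group R\<^esub> C =
      A \<otimes>\<^bsub>presented_group R\<^esub> (B \<otimes>\<^bsub>presented_group R\<^esub> C)"
    by (simp add: u v w presented_group_mult)
qed

subsection \<open>Generalized quaternion groups\<close>

datatype quat_gen = X | Y

text \<open>The relations \<open>x ^ (2 ^ k) = 1\<close>, \<open>x ^ (2 ^ (k - 1)) = y ^ 2\<close> and \<open>y\<inverse> x y = x\<inverse>\<close>.\<close>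

definition quat_relations :: "nat \<Rightarrow> (quat_gen word \<times> quat_gen word) set" where
  "quat_relations k =
    { (replicate (2 ^ k) (X, False), []),
      (replicate (2 ^ (k - 1)) (X, False), [(Y, False), (Y, False)]),
      ([(Y, True), (X, False), (Y, False)], [(X, True)]) }"

definition generalized_quaternion :: "('a, 'b) monoid_scheme \<Rightarrow> bool" where
  "generalized_quaternion G \<longleftrightarrow>
    group G \<and> (\<exists>k\<ge>2. G \<cong> presented_group (quat_relations k))"

section \<open>Power graph\<close>

text \<open>A simple undirected graph is a symmetric loop-free digraph without parallel arcs.\<close>

definition power_graph :: "('a, 'b) monoid_scheme \<Rightarrow> 'a pair_pre_digraph" where
  "power_graph G =
    \<lparr> pverts = carrier G,
      parcs = {(a, b). a \<in> carrier G \<and> b \<in> carrier G \<and> a \<noteq> b \<and>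
        ((\<exists>n::nat. n > 0 \<and> a = b [^]\<^bsub>G\<^esub> n) \<or> (\<exists>m::nat. m > 0 \<and> b = a [^]\<^bsub>G\<^esub> m))} \<rparr>"

lemma pair_graph_power_graph:
  assumes "finite (carrier G)"
  shows "pair_graph (power_graph G)"
proof
  show "finite (parcs (power_graph G))"
    by (rule finite_subset[of _ "carrier G \<times> carrier G"]) (auto simp: power_graph_def assms)
  show "symmetric (with_proj (power_graph G))"
    by (auto simp: symmetric_def power_graph_def intro!: symI)
qed (auto simp: power_graph_def assms)

section \<open>Labellings and the lambda number\<close>

definition graph_dist :: "('a, 'b) pre_digraph \<Rightarrow> 'a \<Rightarrow> 'a \<Rightarrow> ereal" where
  "graph_dist \<Gamma> u v = wf_digraph.\<mu> \<Gamma> (\<lambda>_. 1) u v"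

definition L21_labelling :: "('a, 'b) pre_digraph \<Rightarrow> ('a \<Rightarrow> int) \<Rightarrow> bool" where
  "L21_labelling \<Gamma> f \<longleftrightarrow> (\<forall>a\<in>verts \<Gamma>. \<forall>b\<in>verts \<Gamma>.
    (graph_dist \<Gamma> a b = 1 \<longrightarrow> \<bar>f a - f b\<bar> \<ge> 2) \<and>
    (graph_dist \<Gamma> a b = 2 \<longrightarrow> \<bar>f a - f b\<bar> \<ge> 1))"

definition label_span :: "('a, 'b) pre_digraph \<Rightarrow> ('a \<Rightarrow> int) \<Rightarrow> int" where
  "label_span \<Gamma> f = Max (f ` verts \<Gamma>) - Min (f ` verts \<Gamma>)"

definition lambda_number :: "('a, 'b) pre_digraph \<Rightarrow> int" where
  "lambda_number \<Gamma> = (LEAST s. \<exists>f. L21_labelling \<Gamma> f \<and> s = label_span \<Gamma> f)"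

text \<open>The set of spans is infinite in general, but its minimum is attained.\<close>

lemma label_span_nonneg:
  assumes "finite (verts \<Gamma>)" "verts \<Gamma> \<noteq> {}"
  shows "label_span \<Gamma> f \<ge> 0"
proof -
  obtain v where "v \<in> verts \<Gamma>" using assms(2) by blast
  then have "Min (f ` verts \<Gamma>) \<le> f v" "f v \<le> Max (f ` verts \<Gamma>)"
    using assms(1) by auto
  then show ?thesis by (simp add: label_span_def)
qed

lemma graph_dist_self:
  assumes "wf_digraph \<Gamma>" "a \<in> verts \<Gamma>"
  shows "graph_dist \<Gamma> a a \<le> 0"
proof -
  interpret wf_digraph \<Gamma> by fact
  have "awalk a [] a" using assms(2) by (simp add: awalk_Nil_iff)
  then have "\<mu> (\<lambda>_. 1) a a \<le> awalk_cost (\<lambda>_. 1) []" by (rule min_cost_le_walk_cost)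
  then show ?thesis by (simp add: graph_dist_def zero_ereal_def)
qed

lemma lambda_number_attained:
  assumes wf: "wf_digraph \<Gamma>" and fin: "finite (verts \<Gamma>)" and ne: "verts \<Gamma> \<noteq> {}"
  shows "\<exists>f. L21_labelling \<Gamma> f \<and> lambda_number \<Gamma> = label_span \<Gamma> f"
    and "L21_labelling \<Gamma> f \<Longrightarrow> lambda_number \<Gamma> \<le> label_span \<Gamma> f"
proof -
  obtain h :: "'a \<Rightarrow> nat" where h: "inj_on h (verts \<Gamma>)"
    using finite_imp_inj_to_nat_seg[OF fin] by blast
  let ?f = "\<lambda>v. 2 * int (h v)"
  have "L21_labelling \<Gamma> ?f"
    unfolding L21_labelling_def
  proof (intro ballI conjI impI)
    fix a b assume ab: "a \<in> verts \<Gamma>" "b \<in> verts \<Gamma>"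
    have *: "\<bar>?f a - ?f b\<bar> \<ge> 2" if "a \<noteq> b"
      using inj_onD[OF h _ ab] that by (cases "h a = h b") auto
    show "\<bar>?f a - ?f b\<bar> \<ge> 2" if d: "graph_dist \<Gamma> a b = 1"
      using * graph_dist_self[OF wf ab(1)] d by (cases "a = b") auto
    show "\<bar>?f a - ?f b\<bar> \<ge> 1" if d: "graph_dist \<Gamma> a b = 2"
      using * graph_dist_self[OF wf ab(1)] d by (cases "a = b") auto
  qed
  then obtain g where g: "L21_labelling \<Gamma> g"
      and min: "\<forall>f'. L21_labelling \<Gamma> f' \<longrightarrow> nat (label_span \<Gamma> g) \<le> nat (label_span \<Gamma> f')"
    using ex_has_least_nat[of "L21_labelling \<Gamma>" ?f "\<lambda>f. nat (label_span \<Gamma> f)"] by blast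
  have le: "label_span \<Gamma> g \<le> label_span \<Gamma> f'" if "L21_labelling \<Gamma> f'" for f'
    using min that label_span_nonneg[OF fin ne] by (simp add: nat_le_eq_zle)
  have eq: "lambda_number \<Gamma> = label_span \<Gamma> g"
    unfolding lambda_number_def by (rule Least_equality) (use g le in auto)
  show "\<exists>f. L21_labelling \<Gamma> f \<and> lambda_number \<Gamma> = label_span \<Gamma> f"
    using g eq by blast
  show "L21_labelling \<Gamma> f \<Longrightarrow> lambda_number \<Gamma> \<le> label_span \<Gamma> f"
    using le eq by simp
qed

end

theory Submission
  imports Defs "HOL-Algebra.Group_Action"
begin

text \<open>
  The identity is adjacent to all other vertices of the power graph. So all labels differ, and next
  to the label of the identity there is a hole. This gives the lower bound \<open>|G|\<close>, which is attained
  exactly when the identity has an extreme label and the other elements carry consecutive labels,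
  that is, form a Hamiltonian path of the complement (\<open>lambda_number_one_universal\<close>).

  Two elements are adjacent if and only if one lies in the cyclic subgroup generated by the other,
  and the subgroups of a cyclic \<open>p\<close>-group form a chain (\<open>cyclic_chain\<close>). So a cyclic \<open>G\<close> has a complete
  power graph. In general, removing the identity separates the elements according to the subgroup of
  order \<open>p\<close> among their powers.

  Suppose there are two subgroups of order \<open>p\<close>, and let \<open>t\<close> generate the one below fewer elements.
  The elements that do not have \<open>t\<close> among their powers fall into cosets of \<open>\<langle>t\<rangle>\<close>, each of them
  independent. When a coset containing an element of least order is left to the end, one can always
  enter it from the cosets before it without using an edge (\<open>avoids_path\<close>). The elements above \<open>t\<close> are adjacent
  to none of these and not more numerous, and are interspersed
  (\<open>hamiltonian_path_two_subgroups\<close>).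

  It remains to know the \<open>p\<close>-groups with a single subgroup of order \<open>p\<close>: they are cyclic or, for
  \<open>p = 2\<close>, generalized quaternion (\<open>unique_subgroup_order_p\<close>). A maximal normal cyclic subgroup
  \<open>\<langle>a\<rangle>\<close> is its own centralizer. For \<open>g\<close> outside with \<open>g^p\<close> inside, no element \<open>a^i g\<close> may have order \<open>p\<close>,
  and a computation with exponents shows that then \<open>p = 2\<close> and \<open>g\<close> inverts \<open>a\<close>
  (\<open>cyclic_extension_dichotomy\<close>). The generators \<open>a\<close> and \<open>g\<close> satisfy the quaternion relations; that
  these present a group of the right order is seen from an action of words on normal forms
  (\<open>quat_steps_cong\<close>).

  In a generalized quaternion group the unique involution is a second universal vertex, which costs
  one more hole. The identity and the involution get the two extreme labels, and the remaining
  elements again form a Hamiltonian path of the complement (\<open>quaternion_hamiltonian_path\<close>).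
\<close>

section \<open>Labellings of graphs with a universal vertex\<close>

lemma graph_dist_ge_1:
  assumes "wf_digraph \<Gamma>" "a \<noteq> b"
  shows "1 \<le> graph_dist \<Gamma> a b"
proof -
  interpret wf_digraph \<Gamma> by fact
  have "1 \<le> ereal (awalk_cost (\<lambda>_. 1) p)" if "awalk a p b" for p
  proof (cases p)
    case Nil
    then show ?thesis using that assms by (simp add: awalk_Nil_iff)
  next
    case (Cons e q)
    then have "0 \<le> awalk_cost (\<lambda>_. 1) q"
      using that by (auto simp: awalk_Cons_iff intro!: pos_cost_pos_awalk_cost)
    then show ?thesis using Cons by (simp add: one_ereal_def)
  qed
  then show ?thesis
    unfolding graph_dist_def \<mu>_def by (auto intro!: INF_greatest)
qed

lemma graph_dist_ge_2:
  assumes "wf_digraph \<Gamma>" "a \<noteq> b" "(a, b) \<notin> arcs_ends \<Gamma>"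
  shows "2 \<le> graph_dist \<Gamma> a b"
proof -
  interpret wf_digraph \<Gamma> by fact
  have "2 \<le> ereal (awalk_cost (\<lambda>_. 1) p)" if p: "awalk a p b" for p
  proof (cases p)
    case Nil
    then show ?thesis using that assms by (simp add: awalk_Nil_iff)
  next
    case (Cons e q)
    have "q \<noteq> []"
    proof
      assume "q = []"
      then have "e \<in> arcs \<Gamma>" "a = tail \<Gamma> e" "b = head \<Gamma> e"
        using p Cons by (auto simp: awalk_Cons_iff awalk_Nil_iff)
      then show False using assms(3) by (auto simp: arcs_ends_def arc_to_ends_def)
    qed
    then obtain e' r where q: "q = e' # r" by (cases q) auto
    then have "0 \<le> awalk_cost (\<lambda>_. 1) r"
      using p Cons by (auto simp: awalk_Cons_iff intro!: pos_cost_pos_awalk_cost)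
    then show ?thesis using Cons q by simp
  qed
  then show ?thesis
    unfolding graph_dist_def \<mu>_def by (auto intro!: INF_greatest)
qed

lemma graph_dist_arc:
  assumes "wf_digraph \<Gamma>" "a \<noteq> b" "(a, b) \<in> arcs_ends \<Gamma>"
  shows "graph_dist \<Gamma> a b = 1"
proof -
  interpret wf_digraph \<Gamma> by fact
  obtain e where e: "e \<in> arcs \<Gamma>" "tail \<Gamma> e = a" "head \<Gamma> e = b"
    using assms(3) by (auto simp: arcs_ends_def arc_to_ends_def)
  then have "awalk a [e] b" by (auto simp: awalk_Cons_iff awalk_Nil_iff)
  from min_cost_le_walk_cost[OF this, of "\<lambda>_. 1"]
  have "graph_dist \<Gamma> a b \<le> 1" by (simp add: graph_dist_def one_ereal_def)
  with graph_dist_ge_1[OF assms(1,2)] show ?thesis by simp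
qed

lemma graph_dist_via:
  assumes "wf_digraph \<Gamma>" "a \<noteq> b" "(a, b) \<notin> arcs_ends \<Gamma>"
    and "(a, u) \<in> arcs_ends \<Gamma>" "(u, b) \<in> arcs_ends \<Gamma>"
  shows "graph_dist \<Gamma> a b = 2"
proof -
  interpret wf_digraph \<Gamma> by fact
  obtain e e' where e: "e \<in> arcs \<Gamma>" "tail \<Gamma> e = a" "head \<Gamma> e = u"
      "e' \<in> arcs \<Gamma>" "tail \<Gamma> e' = u" "head \<Gamma> e' = b"
    using assms(4,5) by (force simp: arcs_ends_def arc_to_ends_def)
  then have "awalk a [e, e'] b" by (auto simp: awalk_Cons_iff awalk_Nil_iff)
  from min_cost_le_walk_cost[OF this, of "\<lambda>_. 1"]
  have "graph_dist \<Gamma> a b \<le> 2" by (simp add: graph_dist_def)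
  with graph_dist_ge_2[OF assms(1-3)] show ?thesis by simp
qed

text \<open>Any two vertices have distance at most \<open>2\<close>, through the universal vertex, so the distance
  conditions say that all labels differ and those of neighbours differ by at least \<open>2\<close>.\<close>

lemma L21_labelling_universal_vertex:
  assumes H: "pair_graph H"
    and u: "u \<in> pverts H" "\<And>v. v \<in> pverts H \<Longrightarrow> v \<noteq> u \<Longrightarrow> (u, v) \<in> parcs H"
  shows "L21_labelling (with_proj H) f \<longleftrightarrow>
    inj_on f (pverts H) \<and> (\<forall>(a, b) \<in> parcs H. 2 \<le> \<bar>f a - f b\<bar>)"
proof -
  interpret pair_graph H by fact
  have wf: "wf_digraph (with_proj H)" by unfold_locales
  have ae: "arcs_ends (with_proj H) = parcs H"
    by (auto simp: arcs_ends_def arc_to_ends_def)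
  have sym: "(b, a) \<in> parcs H" if "(a, b) \<in> parcs H" for a b
    using that arcs_symmetric by blast
  have neq: "a \<noteq> b" if "(a, b) \<in> parcs H" for a b
    using that no_loops by force
  have dist1: "graph_dist (with_proj H) a b = 1" if "(a, b) \<in> parcs H" for a b
    using graph_dist_arc[OF wf neq[OF that]] that ae by simp
  have dist2: "graph_dist (with_proj H) a b = 2"
    if "(a, b) \<notin> parcs H" "a \<noteq> b" "a \<in> pverts H" "b \<in> pverts H" for a b
  proof -
    have "a \<noteq> u" "b \<noteq> u" using that u sym by blast+
    then show ?thesis
      using graph_dist_via[OF wf that(2), of u] that u sym ae by simp
  qed
  have dist0: "graph_dist (with_proj H) a a \<le> 0" if "a \<in> pverts H" for a
    using graph_dist_self[OF wf] that by simp
  show ?thesis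
  proof
    assume L: "L21_labelling (with_proj H) f"
    have "2 \<le> \<bar>f a - f b\<bar>" if "(a, b) \<in> parcs H" for a b
      using L dist1[OF that] that in_arcsD1 in_arcsD2 unfolding L21_labelling_def by force
    moreover have "inj_on f (pverts H)"
    proof (rule inj_onI, rule ccontr)
      fix a b assume ab: "a \<in> pverts H" "b \<in> pverts H" "f a = f b" "a \<noteq> b"
      show False
      proof (cases "(a, b) \<in> parcs H")
        case True
        then show False using L dist1[OF True] ab unfolding L21_labelling_def by force
      next
        case False
        then show False using L dist2[OF False] ab unfolding L21_labelling_def by force
      qed
    qed
    ultimately show "inj_on f (pverts H) \<and> (\<forall>(a, b) \<in> parcs H. 2 \<le> \<bar>f a - f b\<bar>)" by auto
  next
    assume R: "inj_on f (pverts H) \<and> (\<forall>(a, b) \<in> parcs H. 2 \<le> \<bar>f a - f b\<bar>)"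
    show "L21_labelling (with_proj H) f"
      unfolding L21_labelling_def
    proof (intro ballI conjI impI)
      fix a b assume ab: "a \<in> verts (with_proj H)" "b \<in> verts (with_proj H)"
      show "2 \<le> \<bar>f a - f b\<bar>" if d: "graph_dist (with_proj H) a b = 1"
      proof -
        have "a \<noteq> b" using d dist0 ab by force
        then have "(a, b) \<in> parcs H" using dist2[of a b] d ab by force
        then show ?thesis using R by auto
      qed
      show "1 \<le> \<bar>f a - f b\<bar>" if d: "graph_dist (with_proj H) a b = 2"
      proof -
        have "a \<noteq> b" using d dist0 ab by force
        then have "f a \<noteq> f b" using R ab by (auto dest: inj_onD)
        then show ?thesis by simp
      qed
    qed
  qed
qed

section \<open>Spans, holes and Hamiltonian paths of the complement\<close>

lemma label_span_ge_holes:
  assumes fin: "finite (verts \<Gamma>)" and ne: "verts \<Gamma> \<noteq> {}" and inj: "inj_on f (verts \<Gamma>)"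
    and holes: "h \<subseteq> {Min (f ` verts \<Gamma>)..Max (f ` verts \<Gamma>)}" "h \<inter> f ` verts \<Gamma> = {}"
  shows "int (card (verts \<Gamma>)) + int (card h) \<le> label_span \<Gamma> f + 1"
proof -
  let ?I = "{Min (f ` verts \<Gamma>)..Max (f ` verts \<Gamma>)}"
  have sub: "f ` verts \<Gamma> \<union> h \<subseteq> ?I" using holes fin by auto
  have finh: "finite h" using holes(1) finite_subset by blast
  have "card (verts \<Gamma>) + card h = card (f ` verts \<Gamma> \<union> h)"
    using holes(2) fin finh by (subst card_Un_disjoint) (auto simp: card_image[OF inj])
  also have "\<dots> \<le> card ?I" using sub by (intro card_mono) auto
  finally show ?thesis
    using label_span_nonneg[OF fin ne, of f] by (simp add: label_span_def)
qed

text \<open>No label may sit next to that of a universal vertex, so a universal vertex leaves a hole on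
  every side on which further labels occur.\<close>

lemma label_span_ge_universal:
  assumes fin: "finite (verts \<Gamma>)" and inj: "inj_on f (verts \<Gamma>)"
    and u: "u \<in> verts \<Gamma>" "\<And>v. v \<in> verts \<Gamma> \<Longrightarrow> v \<noteq> u \<Longrightarrow> 2 \<le> \<bar>f u - f v\<bar>"
    and card: "2 \<le> card (verts \<Gamma>)"
  shows "int (card (verts \<Gamma>)) \<le> label_span \<Gamma> f"
proof -
  let ?m = "Min (f ` verts \<Gamma>)" and ?M = "Max (f ` verts \<Gamma>)"
  have ne: "verts \<Gamma> \<noteq> {}" using u by auto
  have bd: "?m \<le> f v" "f v \<le> ?M" if "v \<in> verts \<Gamma>" for v using that fin by auto
  obtain w where w: "w \<in> verts \<Gamma>" "w \<noteq> u"
    using card by (metis card_2_iff' card_le_Suc0_iff_eq fin not_less_eq_eq numeral_2_eq_2)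
  have not: "f u + 1 \<notin> f ` verts \<Gamma>" "f u - 1 \<notin> f ` verts \<Gamma>"
    using u(2) by force+
  have "f u + 1 \<in> {?m..?M} \<or> f u - 1 \<in> {?m..?M}"
    using bd[OF u(1)] bd[OF w(1)] u(2)[OF w] by auto
  then obtain c where "c \<in> {?m..?M}" "c \<notin> f ` verts \<Gamma>" using not by blast
  then show ?thesis using label_span_ge_holes[OF fin ne inj, of "{c}"] by auto
qed

lemma label_span_ge_two_universal:
  assumes fin: "finite (verts \<Gamma>)" and inj: "inj_on f (verts \<Gamma>)"
    and u: "u \<in> verts \<Gamma>" "\<And>v. v \<in> verts \<Gamma> \<Longrightarrow> v \<noteq> u \<Longrightarrow> 2 \<le> \<bar>f u - f v\<bar>"
    and z: "z \<in> verts \<Gamma>" "\<And>v. v \<in> verts \<Gamma> \<Longrightarrow> v \<noteq> z \<Longrightarrow> 2 \<le> \<bar>f z - f v\<bar>"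
    and "u \<noteq> z" and card: "3 \<le> card (verts \<Gamma>)"
  shows "int (card (verts \<Gamma>)) + 1 \<le> label_span \<Gamma> f"
proof -
  let ?m = "Min (f ` verts \<Gamma>)" and ?M = "Max (f ` verts \<Gamma>)"
  have ne: "verts \<Gamma> \<noteq> {}" using u by auto
  have bd: "?m \<le> f v" "f v \<le> ?M" if "v \<in> verts \<Gamma>" for v using that fin by auto
  have "\<not> verts \<Gamma> \<subseteq> {u, z}"
  proof
    assume "verts \<Gamma> \<subseteq> {u, z}"
    then have "card (verts \<Gamma>) \<le> card {u, z}" by (intro card_mono) auto
    then show False using card \<open>u \<noteq> z\<close> by simp
  qed
  then obtain w where w: "w \<in> verts \<Gamma>" "w \<noteq> u" "w \<noteq> z" by blast
  have not: "f u + 1 \<notin> f ` verts \<Gamma>" "f u - 1 \<notin> f ` verts \<Gamma>"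
    "f z + 1 \<notin> f ` verts \<Gamma>" "f z - 1 \<notin> f ` verts \<Gamma>"
    using u(2) z(2) by force+
  \<comment> \<open>The two holes are those on the side of the third vertex.\<close>
  define c where "c = (if f w < f u then f u - 1 else f u + 1)"
  define d where "d = (if f w < f z then f z - 1 else f z + 1)"
  note far = u(2)[OF w(1,2)] z(2)[OF w(1,3)] u(2)[OF z(1)]
  have cd: "c \<noteq> d" "{c, d} \<subseteq> {?m..?M}"
    using far bd[OF u(1)] bd[OF z(1)] bd[OF w(1)] \<open>u \<noteq> z\<close> unfolding c_def d_def by auto
  have "{c, d} \<inter> f ` verts \<Gamma> = {}" using not unfolding c_def d_def by auto
  then show ?thesis using label_span_ge_holes[OF fin ne inj cd(2)] cd(1) by simp
qed

lemma label_span_ge_complete: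
  assumes fin: "finite (verts \<Gamma>)" and ne: "verts \<Gamma> \<noteq> {}"
    and far: "\<And>u v. u \<in> verts \<Gamma> \<Longrightarrow> v \<in> verts \<Gamma> \<Longrightarrow> u \<noteq> v \<Longrightarrow> 2 \<le> \<bar>f u - f v\<bar>"
  shows "2 * (int (card (verts \<Gamma>)) - 1) \<le> label_span \<Gamma> f"
proof -
  let ?L = "f ` verts \<Gamma>"
  have inj: "inj_on f (verts \<Gamma>)" using far by (force intro: inj_onI)
  have "Max ?L \<in> ?L" using fin ne by simp
  then obtain w where w: "w \<in> verts \<Gamma>" "f w = Max ?L" by auto
  \<comment> \<open>All labels but the largest one leave a hole directly above them.\<close>
  let ?h = "(\<lambda>v. f v + 1) ` (verts \<Gamma> - {w})"
  have "card ?h = card (verts \<Gamma>) - 1"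
    using w inj fin by (subst card_image) (auto simp: inj_on_def)
  moreover have "?h \<inter> ?L = {}" using far by force
  moreover have "?h \<subseteq> {Min ?L..Max ?L}"
  proof
    fix c assume "c \<in> ?h"
    then obtain v where v: "v \<in> verts \<Gamma>" "v \<noteq> w" "c = f v + 1" by auto
    then have "Min ?L \<le> f v" "f v \<le> Max ?L" using fin by auto
    then show "c \<in> {Min ?L..Max ?L}" using far[OF v(1) w(1) v(2)] v(3) w(2) by auto
  qed
  moreover have "card (verts \<Gamma>) \<ge> 1" using fin ne by (simp add: Suc_le_eq card_gt_0_iff)
  ultimately show ?thesis using label_span_ge_holes[OF fin ne inj, of ?h] by simp
qed

lemma label_span_le:
  assumes "finite (verts \<Gamma>)" "verts \<Gamma> \<noteq> {}" "\<And>v. v \<in> verts \<Gamma> \<Longrightarrow> 0 \<le> f v \<and> f v \<le> s"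
  shows "label_span \<Gamma> f \<le> s"
proof -
  have "Max (f ` verts \<Gamma>) \<in> f ` verts \<Gamma>" "Min (f ` verts \<Gamma>) \<in> f ` verts \<Gamma>"
    using assms by simp_all
  then have "Max (f ` verts \<Gamma>) \<le> s" "0 \<le> Min (f ` verts \<Gamma>)" using assms(3) by auto
  then show ?thesis by (simp add: label_span_def)
qed

text \<open>Only consecutive positions differ by less than \<open>2\<close>, and consecutive entries are not adjacent.
  Hence positions in a path of the complement are admissible labels.\<close>

lemma path_index:
  assumes "distinct xs" "successively (\<lambda>a b. \<not> E a b \<and> \<not> E b a) xs"
  obtains ix :: "'a \<Rightarrow> nat" where "\<And>a. a \<in> set xs \<Longrightarrow> ix a < length xs"
    "inj_on ix (set xs)"
    "\<And>a b. a \<in> set xs \<Longrightarrow> b \<in> set xs \<Longrightarrow> a \<noteq> b \<Longrightarrow> E a b \<Longrightarrow> 2 \<le> \<bar>int (ix a) - int (ix b)\<bar>"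
proof -
  have bij: "bij_betw ((!) xs) {..<length xs} (set xs)"
    using assms(1) by (simp add: bij_betw_nth)
  let ?ix = "inv_into {..<length xs} ((!) xs)"
  have ix: "?ix a < length xs" "xs ! ?ix a = a" if "a \<in> set xs" for a
    using bij_betwE[OF bij_betw_inv_into[OF bij]] bij_betw_inv_into_right[OF bij] that by auto
  have step: "\<not> E (xs ! i) (xs ! Suc i) \<and> \<not> E (xs ! Suc i) (xs ! i)" if "Suc i < length xs" for i
    using assms(2) that by (simp add: successively_conv_nth)
  have inj: "inj_on ?ix (set xs)" by (metis ix(2) inj_onI)
  have "2 \<le> \<bar>int (?ix a) - int (?ix b)\<bar>"
    if ab: "a \<in> set xs" "b \<in> set xs" "a \<noteq> b" "E a b" for a b
  proof -
    have "?ix a \<noteq> ?ix b" using inj ab by (meson inj_onD)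
    moreover have "?ix a \<noteq> Suc (?ix b)" using step[of "?ix b"] ix ab by metis
    moreover have "?ix b \<noteq> Suc (?ix a)" using step[of "?ix a"] ix ab by metis
    ultimately show ?thesis by linarith
  qed
  then show ?thesis using that ix(1) inj by blast
qed

lemma lambda_number_le:
  assumes H: "pair_graph H"
    and u: "u \<in> pverts H" "\<And>v. v \<in> pverts H \<Longrightarrow> v \<noteq> u \<Longrightarrow> (u, v) \<in> parcs H"
    and f: "inj_on f (pverts H)" "\<And>a b. (a, b) \<in> parcs H \<Longrightarrow> 2 \<le> \<bar>f a - f b\<bar>"
      "\<And>v. v \<in> pverts H \<Longrightarrow> 0 \<le> f v \<and> f v \<le> s"
  shows "lambda_number (with_proj H) \<le> s"
proof -
  interpret pair_graph H by fact
  have wf: "wf_digraph (with_proj H)" by unfold_locales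
  have fin: "finite (verts (with_proj H))" by simp
  have ne: "verts (with_proj H) \<noteq> {}" using u by auto
  have "L21_labelling (with_proj H) f"
    using L21_labelling_universal_vertex[OF H u] f by auto
  then have "lambda_number (with_proj H) \<le> label_span (with_proj H) f"
    by (rule lambda_number_attained(2)[OF wf fin ne])
  also have "\<dots> \<le> s" using label_span_le[OF fin ne] f(3) by simp
  finally show ?thesis .
qed

lemma lambda_number_ge:
  assumes H: "pair_graph H"
    and u: "u \<in> pverts H" "\<And>v. v \<in> pverts H \<Longrightarrow> v \<noteq> u \<Longrightarrow> (u, v) \<in> parcs H"
    and f: "\<And>f. inj_on f (pverts H) \<Longrightarrow> (\<And>a b. (a, b) \<in> parcs H \<Longrightarrow> 2 \<le> \<bar>f a - f b\<bar>)
      \<Longrightarrow> s \<le> label_span (with_proj H) f"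
  shows "s \<le> lambda_number (with_proj H)"
proof -
  interpret pair_graph H by fact
  have wf: "wf_digraph (with_proj H)" by unfold_locales
  have fin: "finite (verts (with_proj H))" by simp
  have ne: "verts (with_proj H) \<noteq> {}" using u by auto
  obtain f where "L21_labelling (with_proj H) f"
      "lambda_number (with_proj H) = label_span (with_proj H) f"
    using lambda_number_attained(1)[OF wf fin ne] by blast
  then show ?thesis
    using L21_labelling_universal_vertex[OF H u] assms(4)[of f] by auto
qed

theorem lambda_number_complete:
  assumes H: "pair_graph H" and ne: "pverts H \<noteq> {}"
    and arc: "\<And>a b. a \<in> pverts H \<Longrightarrow> b \<in> pverts H \<Longrightarrow> a \<noteq> b \<Longrightarrow> (a, b) \<in> parcs H"
  shows "lambda_number (with_proj H) = 2 * (int (card (pverts H)) - 1)"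
proof (rule antisym)
  interpret pair_graph H by fact
  obtain u where u: "u \<in> pverts H" using ne by blast
  have uv: "\<And>v. v \<in> pverts H \<Longrightarrow> v \<noteq> u \<Longrightarrow> (u, v) \<in> parcs H" using arc u by simp
  show "2 * (int (card (pverts H)) - 1) \<le> lambda_number (with_proj H)"
    using label_span_ge_complete[of "with_proj H"] ne arc
    by (intro lambda_number_ge[OF H u uv]) auto
  obtain ix :: "_ \<Rightarrow> nat" where bij: "bij_betw ix (pverts H) {0..<card (pverts H)}"
    using ex_bij_betw_finite_nat[OF finite_verts] by auto
  have inj: "inj_on ix (pverts H)" using bij by (simp add: bij_betw_def)
  have lt: "ix v < card (pverts H)" if "v \<in> pverts H" for v
    using bij_betwE[OF bij] that by auto
  show "lambda_number (with_proj H) \<le> 2 * (int (card (pverts H)) - 1)"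
  proof (rule lambda_number_le[OF H u uv, where f = "\<lambda>v. 2 * int (ix v)"])
    show "inj_on (\<lambda>v. 2 * int (ix v)) (pverts H)" using inj by (auto simp: inj_on_def)
    fix a b assume ab: "(a, b) \<in> parcs H"
    then have "ix a \<noteq> ix b"
      using inj no_loops[OF ab] in_arcsD1[OF ab] in_arcsD2[OF ab] by (auto dest: inj_onD)
    then show "2 \<le> \<bar>2 * int (ix a) - 2 * int (ix b)\<bar>" by linarith
  next
    fix v assume "v \<in> pverts H"
    from lt[OF this] show "0 \<le> 2 * int (ix v) \<and> 2 * int (ix v) \<le> 2 * (int (card (pverts H)) - 1)"
      by auto
  qed
qed

text \<open>The universal vertex gets an end of the range, which costs a single hole; the path fills the
  rest of the range.\<close>

theorem lambda_number_one_universal: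
  assumes H: "pair_graph H"
    and u: "u \<in> pverts H" "\<And>v. v \<in> pverts H \<Longrightarrow> v \<noteq> u \<Longrightarrow> (u, v) \<in> parcs H"
    and xs: "distinct xs" "set xs = pverts H - {u}" "xs \<noteq> []"
      "successively (\<lambda>a b. (a, b) \<notin> parcs H \<and> (b, a) \<notin> parcs H) xs"
  shows "lambda_number (with_proj H) = int (card (pverts H))"
proof (rule antisym)
  interpret pair_graph H by fact
  have len: "length xs + 1 = card (pverts H)"
    using distinct_card[OF xs(1)] xs(2) u(1) card_Suc_Diff1[OF finite_verts u(1)] by simp
  then have card2: "2 \<le> card (pverts H)" using xs(3) by (cases xs) auto
  show "int (card (pverts H)) \<le> lambda_number (with_proj H)"
    using label_span_ge_universal[of "with_proj H" _ u] u card2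
    by (intro lambda_number_ge[OF H u]) auto
  obtain ix :: "_ \<Rightarrow> nat" where ix: "\<And>a. a \<in> set xs \<Longrightarrow> ix a < length xs" "inj_on ix (set xs)"
    "\<And>a b. a \<in> set xs \<Longrightarrow> b \<in> set xs \<Longrightarrow> a \<noteq> b \<Longrightarrow> (a, b) \<in> parcs H \<Longrightarrow>
      2 \<le> \<bar>int (ix a) - int (ix b)\<bar>"
    using path_index[OF xs(1), where E = "\<lambda>a b. (a, b) \<in> parcs H"] xs(4) by blast
  let ?f = "\<lambda>v. if v = u then 0 else int (ix v) + 2"
  show "lambda_number (with_proj H) \<le> int (card (pverts H))"
  proof (rule lambda_number_le[OF H u, where f = ?f])
    show "inj_on ?f (pverts H)" using ix(2) xs(2) by (auto simp: inj_on_def)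
    fix a b assume ab: "(a, b) \<in> parcs H"
    then have "a \<noteq> b" "a \<in> pverts H" "b \<in> pverts H"
      using no_loops[OF ab] in_arcsD1[OF ab] in_arcsD2[OF ab] by auto
    then consider "a = u" | "b = u" | "a \<in> set xs" "b \<in> set xs"
      using xs(2) by blast
    then show "2 \<le> \<bar>?f a - ?f b\<bar>"
    proof cases
      case 1 with \<open>a \<noteq> b\<close> show ?thesis by simp
    next
      case 2 with \<open>a \<noteq> b\<close> show ?thesis by simp
    next
      case 3
      then have "a \<noteq> u" "b \<noteq> u" using xs(2) by auto
      with ix(3)[OF 3 \<open>a \<noteq> b\<close> ab] show ?thesis by simp
    qed
  next
    fix v assume v: "v \<in> pverts H"
    show "0 \<le> ?f v \<and> ?f v \<le> int (card (pverts H))"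
    proof (cases "v = u")
      case False
      then have "ix v < length xs" using v ix(1) xs(2) by simp
      with False len show ?thesis by simp
    qed simp
  qed
qed

text \<open>With a second universal vertex the path lies between two holes, and the universal vertices
  occupy both ends.\<close>

theorem lambda_number_two_universal:
  assumes H: "pair_graph H"
    and u: "u \<in> pverts H" "\<And>v. v \<in> pverts H \<Longrightarrow> v \<noteq> u \<Longrightarrow> (u, v) \<in> parcs H"
    and z: "z \<in> pverts H" "\<And>v. v \<in> pverts H \<Longrightarrow> v \<noteq> z \<Longrightarrow> (z, v) \<in> parcs H" "u \<noteq> z"
    and xs: "distinct xs" "set xs = pverts H - {u, z}" "xs \<noteq> []"
      "successively (\<lambda>a b. (a, b) \<notin> parcs H \<and> (b, a) \<notin> parcs H) xs"
  shows "lambda_number (with_proj H) = int (card (pverts H)) + 1"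
proof (rule antisym)
  interpret pair_graph H by fact
  have "card (set xs) + card {u, z} = card (pverts H)"
    using u(1) z(1) unfolding xs(2) by (subst card_Diff_subset) (auto simp: card_mono)
  then have len: "length xs + 2 = card (pverts H)"
    using distinct_card[OF xs(1)] z(3) by simp
  then have card3: "3 \<le> card (pverts H)" using xs(3) by (cases xs) auto
  show "int (card (pverts H)) + 1 \<le> lambda_number (with_proj H)"
    using label_span_ge_two_universal[of "with_proj H" _ u z] u z card3
    by (intro lambda_number_ge[OF H u]) auto
  obtain ix :: "_ \<Rightarrow> nat" where ix: "\<And>a. a \<in> set xs \<Longrightarrow> ix a < length xs" "inj_on ix (set xs)"
    "\<And>a b. a \<in> set xs \<Longrightarrow> b \<in> set xs \<Longrightarrow> a \<noteq> b \<Longrightarrow> (a, b) \<in> parcs H \<Longrightarrow>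
      2 \<le> \<bar>int (ix a) - int (ix b)\<bar>"
    using path_index[OF xs(1), where E = "\<lambda>a b. (a, b) \<in> parcs H"] xs(4) by blast
  have lt: "int (ix a) < int (length xs)" if "a \<in> pverts H" "a \<noteq> u" "a \<noteq> z" for a
    using ix(1) that xs(2) by simp
  have mid: "2 \<le> \<bar>int (ix a) - int (ix b)\<bar>"
    if "(a, b) \<in> parcs H" "a \<notin> {u, z}" "b \<notin> {u, z}" for a b
    using ix(3)[of a b] that no_loops[OF that(1)] in_arcsD1[OF that(1)] in_arcsD2[OF that(1)]
    unfolding xs(2) by simp
  let ?f = "\<lambda>v. if v = u then 0 else if v = z then int (length xs) + 3 else int (ix v) + 2"
  show "lambda_number (with_proj H) \<le> int (card (pverts H)) + 1"
  proof (rule lambda_number_le[OF H u, where f = ?f])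
    show "inj_on ?f (pverts H)"
    proof (rule inj_onI)
      fix a b assume "a \<in> pverts H" "b \<in> pverts H" "?f a = ?f b"
      then show "a = b"
        using lt[of a] lt[of b] inj_onD[OF ix(2), of a b] xs(2) by (auto split: if_splits)
    qed
    fix a b assume ab: "(a, b) \<in> parcs H"
    then have "a \<noteq> b" "a \<in> pverts H" "b \<in> pverts H"
      using no_loops[OF ab] in_arcsD1[OF ab] in_arcsD2[OF ab] by auto
    then consider "a = u" | "b = u" | "a = z" "b \<notin> {u, z}" | "b = z" "a \<notin> {u, z}"
      | "a \<notin> {u, z}" "b \<notin> {u, z}" by blast
    then show "2 \<le> \<bar>?f a - ?f b\<bar>"
    proof cases
      case 1 with \<open>a \<noteq> b\<close> show ?thesis by simp
    next
      case 2 with \<open>a \<noteq> b\<close> show ?thesis by simp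
    next
      case 3 with lt[of b] \<open>b \<in> pverts H\<close> z(3) show ?thesis by simp
    next
      case 4 with lt[of a] \<open>a \<in> pverts H\<close> z(3) show ?thesis by simp
    next
      case 5 with mid[OF ab] show ?thesis by simp
    qed
  next
    fix v assume v: "v \<in> pverts H"
    show "0 \<le> ?f v \<and> ?f v \<le> int (card (pverts H)) + 1"
    proof (cases "v = u \<or> v = z")
      case True
      then show ?thesis using len by auto
    next
      case False
      then have "int (ix v) < int (length xs)" using lt v by simp
      with False len show ?thesis by simp
    qed
  qed
qed

section \<open>Cyclic subgroups of finite groups\<close>

context group
begin

lemma generate_eq_nat_pows:
  "finite (carrier G) \<Longrightarrow> a \<in> carrier G \<Longrightarrow> generate G {a} = range (\<lambda>n::nat. a [^] n)"
  using generate_pow_on_finite_carrier by auto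

lemma generate_sub: "a \<in> carrier G \<Longrightarrow> generate G {a} \<subseteq> carrier G"
  using generate_incl by blast

lemma generate_self: "a \<in> generate G {a}"
  by (auto intro: generate.incl)

lemma generate_mono_mem:
  assumes "b \<in> carrier G" "a \<in> generate G {b}"
  shows "generate G {a} \<subseteq> generate G {b}"
  using assms by (intro generate_subgroup_incl generate_is_subgroup) auto

lemma generate_trans:
  assumes "c \<in> carrier G" "a \<in> generate G {b}" "b \<in> generate G {c}"
  shows "a \<in> generate G {c}"
  using generate_mono_mem[OF assms(1,3)] assms(2) by blast

lemma generate_pow_in:
  assumes "a \<in> carrier G" shows "a [^] (n::nat) \<in> generate G {a}"
proof -
  have "a [^] (int n) \<in> generate G {a}" unfolding generate_pow[OF assms] by blast
  then show ?thesis by (simp add: int_pow_int)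
qed

lemma generate_mult:
  assumes "c \<in> carrier G" "a \<in> generate G {c}" "b \<in> generate G {c}"
  shows "a \<otimes> b \<in> generate G {c}"
  using assms generate.eng by fast

lemma generate_inv:
  assumes "c \<in> carrier G" "a \<in> generate G {c}"
  shows "inv a \<in> generate G {c}"
  using assms generate_m_inv_closed[of "{c}"] by auto

lemma generate_sym_if_ord_le:
  assumes fin: "finite (carrier G)" and b: "b \<in> carrier G" and a: "a \<in> generate G {b}"
    and le: "ord b \<le> ord a"
  shows "b \<in> generate G {a}"
proof -
  have ac: "a \<in> carrier G" using a generate_sub[OF b] by blast
  have "generate G {a} = generate G {b}"
  proof (rule card_seteq)
    show "finite (generate G {b})" using finite_subset[OF generate_sub[OF b] fin] .
    show "generate G {a} \<subseteq> generate G {b}" by (rule generate_mono_mem[OF b a])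
    show "card (generate G {b}) \<le> card (generate G {a})"
      using le generate_pow_card[OF ac] generate_pow_card[OF b] by simp
  qed
  then show ?thesis using generate_self by simp
qed

lemma pow_in_generate_pow:
  assumes "finite (carrier G)" "c \<in> carrier G" "gcd j (ord c) dvd i"
  shows "c [^] i \<in> generate G {c [^] (j::nat)}"
proof -
  have "c [^] gcd j (ord c) \<in> generate G {c [^] j}"
  proof (cases "j = 0")
    case True
    then show ?thesis using assms by (simp add: generate.one)
  next
    case False
    obtain u v where "j * u = ord c * v + gcd j (ord c)" using bezout_nat[OF False] by blast
    then have "c [^] (j * u) = c [^] (ord c * v) \<otimes> c [^] gcd j (ord c)"
      using assms by (simp add: nat_pow_mult)
    also have "c [^] (ord c * v) = \<one>" using assms by (simp flip: nat_pow_pow)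
    finally have "c [^] gcd j (ord c) = (c [^] j) [^] u" using assms by (simp add: nat_pow_pow)
    then show ?thesis using generate_pow_in[of "c [^] j" u] assms by simp
  qed
  moreover obtain k where "i = gcd j (ord c) * k" using assms(3) by blast
  then have "c [^] i = (c [^] gcd j (ord c)) [^] k" using assms by (simp add: nat_pow_pow)
  ultimately show ?thesis
    using generate_mono_mem[of "c [^] j" "c [^] gcd j (ord c)"]
      generate_pow_in[of "c [^] gcd j (ord c)" k] assms by auto
qed

end

section \<open>The forest of cyclic subgroups of a \<open>p\<close>-group\<close>

locale prime_power_group = group +
  fixes p :: nat
  assumes p: "prime p" and order_p_power: "\<exists>n. order G = p ^ n"
begin

lemma fin: "finite (carrier G)"
  using order_p_power p order_gt_0_iff_finite by (metis prime_gt_0_nat zero_less_power)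

lemma ord_p_power: "a \<in> carrier G \<Longrightarrow> \<exists>m. ord a = p ^ m"
  using ord_dvd_group_order order_p_power p by (metis divides_primepow_nat)

text \<open>The subgroups of a cyclic \<open>p\<close>-group form a chain, because divisors of a power of \<open>p\<close> do.\<close>

lemma cyclic_chain:
  assumes c: "c \<in> carrier G" and a: "a \<in> generate G {c}" and b: "b \<in> generate G {c}"
  shows "a \<in> generate G {b} \<or> b \<in> generate G {a}"
proof -
  obtain i j :: nat where ij: "a = c [^] i" "b = c [^] j"
    using a b generate_eq_nat_pows[OF fin c] by auto
  obtain m where m: "ord c = p ^ m" using ord_p_power[OF c] by blast
  obtain r s where rs: "gcd i (ord c) = p ^ r" "gcd j (ord c) = p ^ s"
    using divides_primepow_nat[OF p] m by (metis gcd_dvd2)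
  show ?thesis
  proof (cases "r \<le> s")
    case True
    then have "gcd i (ord c) dvd j" using rs by (metis dvd_trans gcd_dvd1 le_imp_power_dvd)
    then show ?thesis using pow_in_generate_pow[OF fin c] ij by blast
  next
    case False
    then have "gcd j (ord c) dvd i" using rs by (metis dvd_trans gcd_dvd1 le_imp_power_dvd nat_le_linear)
    then show ?thesis using pow_in_generate_pow[OF fin c] ij by blast
  qed
qed

lemma generate_order_p:
  assumes t: "t \<in> carrier G" "ord t = p" and a: "a \<in> generate G {t}" "a \<noteq> \<one>"
  shows "t \<in> generate G {a}"
proof (rule generate_sym_if_ord_le[OF fin t(1) a(1)])
  have ac: "a \<in> carrier G" using a generate_sub[OF t(1)] by blast
  obtain k :: nat where "a = t [^] k" using a generate_eq_nat_pows[OF fin t(1)] by auto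
  then have "a [^] p = \<one>" using t by (metis nat_pow_pow mult.commute nat_pow_one pow_ord_eq_1)
  then have "ord a dvd p" using pow_eq_id[OF ac] by simp
  then show "ord t \<le> ord a"
    using ord_eq_1[OF ac] a(2) p t(2) prime_nat_iff by auto
qed

text \<open>Hence adjacent elements other than the identity have the same subgroup of order \<open>p\<close> below
  them.\<close>

lemma order_p_below:
  assumes c: "c \<in> carrier G" and t: "t \<in> carrier G" "ord t = p"
    and "t \<in> generate G {c}" "a \<in> generate G {c}" "a \<noteq> \<one>"
  shows "t \<in> generate G {a}"
  using cyclic_chain[OF c assms(4,5)] generate_order_p[OF t _ assms(6)] by blast

definition comparable :: "'a \<Rightarrow> 'a \<Rightarrow> bool" where
  "comparable a b \<longleftrightarrow> a \<in> generate G {b} \<or> b \<in> generate G {a}"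

lemma comparable_sym: "comparable a b \<Longrightarrow> comparable b a"
  by (auto simp: comparable_def)

definition avoids :: "'a \<Rightarrow> 'a set" where
  "avoids t = {b \<in> carrier G. b \<noteq> \<one> \<and> t \<notin> generate G {b}}"

lemma avoids_shift:
  assumes t: "t \<in> carrier G" "ord t = p" and b: "b \<in> avoids t" and u: "u \<in> generate G {t}"
  shows "b \<otimes> u \<in> avoids t"
proof -
  have bc: "b \<in> carrier G" "b \<noteq> \<one>" "t \<notin> generate G {b}" using b by (auto simp: avoids_def)
  have uc: "u \<in> carrier G" using u generate_sub[OF t(1)] by blast
  let ?c = "b \<otimes> u"
  have cc: "?c \<in> carrier G" using bc uc by simp
  have bT: "b \<notin> generate G {t}" using generate_order_p[OF t] bc by blast
  have "?c \<noteq> \<one>"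
  proof
    assume "?c = \<one>"
    then have "b = inv u" using bc uc by (simp add: inv_equality)
    then show False using bT generate_inv[OF t(1) u] by simp
  qed
  moreover have "t \<notin> generate G {?c}"
  proof
    assume tc: "t \<in> generate G {?c}"
    then have "u \<in> generate G {?c}" using generate_trans[OF cc u] by blast
    then have "?c \<otimes> inv u \<in> generate G {?c}"
      using cc generate_inv generate_mult generate_self by blast
    then have "b \<in> generate G {?c}" using bc uc by (simp add: m_assoc)
    then show False using order_p_below[OF cc t tc] bc by blast
  qed
  ultimately show ?thesis using cc by (simp add: avoids_def)
qed

text \<open>A cyclic group containing \<open>b u\<close> and \<open>b u'\<close> contains their quotient, which generates the same
  group as \<open>t\<close>.\<close>

lemma coset_independent:
  assumes t: "t \<in> carrier G" "ord t = p" and b: "b \<in> avoids t"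
    and u: "u \<in> generate G {t}" "u' \<in> generate G {t}" "u \<noteq> u'"
  shows "\<not> comparable (b \<otimes> u) (b \<otimes> u')"
proof -
  have bc: "b \<in> carrier G" using b by (auto simp: avoids_def)
  have *: "b \<otimes> u' \<notin> generate G {b \<otimes> u}"
    if u: "u \<in> generate G {t}" "u' \<in> generate G {t}" "u \<noteq> u'" for u u'
  proof
    assume in_gen: "b \<otimes> u' \<in> generate G {b \<otimes> u}"
    have uc: "u \<in> carrier G" "u' \<in> carrier G" using u generate_sub[OF t(1)] by auto
    let ?q = "inv u \<otimes> u'"
    have cc: "b \<otimes> u \<in> carrier G" using bc uc by simp
    have "inv (b \<otimes> u) \<otimes> (b \<otimes> u') \<in> generate G {b \<otimes> u}"
      using generate_mult[OF cc generate_inv[OF cc generate_self] in_gen] .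
    moreover have "inv (b \<otimes> u) \<otimes> (b \<otimes> u') = ?q"
      using bc uc by (simp add: inv_mult_group m_assoc) (simp flip: m_assoc)
    moreover have "?q \<noteq> \<one>" using u(3) uc by (metis inv_comm inv_equality inv_inv inv_closed)
    moreover have "?q \<in> generate G {t}" using u t by (intro generate_mult generate_inv)
    ultimately have "t \<in> generate G {b \<otimes> u}"
      using generate_order_p[OF t] generate_trans[OF cc] by metis
    then show False using avoids_shift[OF t b u(1)] by (simp add: avoids_def)
  qed
  show ?thesis using *[OF u] *[OF u(2,1)] u(3) by (auto simp: comparable_def)
qed

lemma above_avoids_incomparable:
  assumes t: "t \<in> carrier G" "ord t = p" and b: "b \<in> avoids t"
    and a: "a \<in> carrier G" "t \<in> generate G {a}"
  shows "\<not> comparable a b"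
proof -
  have bc: "b \<in> carrier G" "b \<noteq> \<one>" "t \<notin> generate G {b}" using b by (auto simp: avoids_def)
  then show ?thesis
    using order_p_below[OF a(1) t a(2)] generate_trans[OF bc(1) a(2)] by (auto simp: comparable_def)
qed

end

section \<open>A Hamiltonian path when there are two subgroups of order \<open>p\<close>\<close>

text \<open>The list \<open>ys\<close> comes first, so that the head of the result stays that of \<open>ys\<close>; this is what
  makes the induction close.\<close>

lemma successively_splice:
  assumes "successively R ys" "\<And>x y. x \<in> set xs \<Longrightarrow> y \<in> set ys \<Longrightarrow> R x y \<and> R y x"
    and "length xs \<le> length ys"
  shows "successively R (splice ys xs) \<and> (ys \<noteq> [] \<longrightarrow> hd (splice ys xs) = hd ys)"
  using assms
proof (induction ys arbitrary: xs)
  case Nil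
  then show ?case by simp
next
  case (Cons y ys)
  show ?case
  proof (cases xs)
    case Nil
    then show ?thesis using Cons.prems by simp
  next
    case (Cons x xs')
    then have IH: "successively R (splice ys xs') \<and> (ys \<noteq> [] \<longrightarrow> hd (splice ys xs') = hd ys)"
      using Cons.prems by (intro Cons.IH) (auto simp: successively_Cons)
    have "splice (y # ys) xs = y # x # splice ys xs'" using Cons by simp
    moreover have "R y x" using Cons.prems(2) Cons by simp
    moreover have "splice ys xs' = [] \<or> R x (hd (splice ys xs'))"
    proof (cases "ys = []")
      case True
      then show ?thesis using Cons.prems(3) Cons by simp
    next
      case False
      then show ?thesis using Cons.prems(2) Cons IH by simp
    qed
    ultimately show ?thesis using IH by (auto simp: successively_Cons)
  qed
qed

lemma successively_pairwise:
  assumes "distinct xs" "\<And>x y. x \<in> set xs \<Longrightarrow> y \<in> set xs \<Longrightarrow> x \<noteq> y \<Longrightarrow> R x y"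
  shows "successively R xs"
  using assms
proof (induction xs)
  case (Cons x xs)
  then show ?case by (cases xs) (auto simp: successively_Cons)
qed simp

context prime_power_group
begin

text \<open>Each coset \<open>b \<langle>t\<rangle>\<close> is independent and may be traversed in any order, so only the steps from one
  coset to the next matter. Visiting the coset of an element \<open>d\<close> of least order last makes that
  step possible: an earlier vertex \<open>v\<close> that is adjacent to both \<open>d\<close> and \<open>d t\<close> would be a power of both,
  against the choice of \<open>d\<close>.\<close>

lemma avoids_path:
  assumes t: "t \<in> carrier G" "ord t = p"
    and S: "S \<subseteq> avoids t" "\<And>b u. b \<in> S \<Longrightarrow> u \<in> generate G {t} \<Longrightarrow> b \<otimes> u \<in> S"
  shows "\<exists>xs. distinct xs \<and> set xs = S \<and> successively (\<lambda>a b. \<not> comparable a b) xs"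
proof -
  have "finite S" using S(1) fin by (auto simp: avoids_def intro: finite_subset)
  then show ?thesis using S
  proof (induction "card S" arbitrary: S rule: less_induct)
    case less
    show ?case
    proof (cases "S = {}")
      case True
      then show ?thesis by (intro exI[of _ "[]"]) simp
    next
      case False
      define d where "d = arg_min_on ord S"
      have d: "d \<in> S" "\<And>b. b \<in> S \<Longrightarrow> ord d \<le> ord b"
        using arg_min_if_finite[OF less.prems(1) False, of ord] unfolding d_def by force+
      have dc: "d \<in> carrier G" "d \<in> avoids t" using d(1) less.prems(2) by (auto simp: avoids_def)
      let ?T = "generate G {t}"
      have Tc: "?T \<subseteq> carrier G" by (rule generate_sub[OF t(1)])
      define K where "K = (\<lambda>u. d \<otimes> u) ` ?T"
      have one: "\<one> \<in> ?T" by (rule generate.one)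
      have dK: "d \<in> K" unfolding K_def using one dc by (auto intro!: image_eqI[of _ _ \<one>])
      have dtK: "d \<otimes> t \<in> K" unfolding K_def using generate_self by auto
      have KS: "K \<subseteq> S" using d(1) less.prems(3) by (auto simp: K_def)
      have Kind: "\<not> comparable x y" if "x \<in> K" "y \<in> K" "x \<noteq> y" for x y
        using that coset_independent[OF t dc(2)] by (auto simp: K_def)
      have "card (S - K) < card S" using d(1) dK less.prems(1) by (intro psubset_card_mono) auto
      moreover have "b \<otimes> u \<in> S - K" if bu: "b \<in> S - K" "u \<in> ?T" for b u
      proof -
        have "b \<otimes> u \<notin> K"
        proof
          assume "b \<otimes> u \<in> K"
          then obtain w where w: "w \<in> ?T" "b \<otimes> u = d \<otimes> w" by (auto simp: K_def)
          have c: "b \<in> carrier G" "u \<in> carrier G" "w \<in> carrier G"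
            using bu w Tc less.prems(2) by (auto simp: avoids_def)
          have "b = d \<otimes> (w \<otimes> inv u)"
            using w(2) c dc by (metis inv_closed inv_solve_right m_assoc m_closed)
          moreover have "w \<otimes> inv u \<in> ?T" using w bu t by (intro generate_mult generate_inv)
          ultimately show False using bu by (auto simp: K_def)
        qed
        then show ?thesis using bu less.prems(3) by blast
      qed
      ultimately obtain xs where xs: "distinct xs" "set xs = S - K"
          "successively (\<lambda>a b. \<not> comparable a b) xs"
        using less.hyps[of "S - K"] less.prems by blast
      have "\<exists>k\<in>K. xs = [] \<or> \<not> comparable (last xs) k"
      proof (cases "xs = []")
        case True
        then show ?thesis using dK by blast
      next
        case False
        define v where "v = last xs"
        have vS: "v \<in> S" using False xs(2) v_def last_in_set by blast
        have vc: "v \<in> carrier G" using vS less.prems(2) by (auto simp: avoids_def)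
        have dtc: "d \<otimes> t \<in> carrier G" using dc t by simp
        have ne: "d \<noteq> d \<otimes> t"
        proof
          assume "d = d \<otimes> t"
          then have "t = \<one>" using dc t by simp
          then show False using t p prime_gt_1_nat[OF p] by simp
        qed
        have nc: "\<not> comparable d (d \<otimes> t)" using Kind[OF dK dtK ne] .
        have "\<not> (comparable v d \<and> comparable v (d \<otimes> t))"
        proof
          assume *: "comparable v d \<and> comparable v (d \<otimes> t)"
          \<comment> \<open>The powers of \<open>v\<close> form a chain, so \<open>v\<close> lies below \<open>d\<close> and \<open>d t\<close>; as \<open>d\<close> has least
            order, \<open>v\<close> generates the same subgroup as \<open>d\<close>.\<close>
          have "v \<in> generate G {d}"
            using * nc cyclic_chain[OF vc, of d "d \<otimes> t"] generate_trans[OF dtc, of d v]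
            by (auto simp: comparable_def)
          moreover have "v \<in> generate G {d \<otimes> t}"
            using * nc cyclic_chain[OF vc, of d "d \<otimes> t"] generate_trans[OF dc(1), of "d \<otimes> t" v]
            by (auto simp: comparable_def)
          moreover have "d \<in> generate G {v}"
          proof -
            have "ord d \<le> ord v" using d(2) vS .
            then show ?thesis
              using generate_sym_if_ord_le[OF fin dc(1) \<open>v \<in> generate G {d}\<close>] by simp
          qed
          ultimately show False using nc generate_trans[OF dtc] by (auto simp: comparable_def)
        qed
        then show ?thesis using dK dtK v_def by blast
      qed
      then obtain k where k: "k \<in> K" "xs = [] \<or> \<not> comparable (last xs) k" by blast
      have "finite (K - {k})" using KS less.prems(1) finite_subset by blast
      then obtain ks where ks: "set ks = K - {k}" "distinct ks"
        using finite_distinct_list by blast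
      have "successively (\<lambda>a b. \<not> comparable a b) (k # ks)"
      proof (rule successively_pairwise)
        show "distinct (k # ks)" using ks by simp
        show "\<not> comparable x y" if "x \<in> set (k # ks)" "y \<in> set (k # ks)" "x \<noteq> y" for x y
          using Kind[of x y] that k(1) ks(1) by auto
      qed
      then have "successively (\<lambda>a b. \<not> comparable a b) (xs @ k # ks)"
        using xs(3) k(2) by (auto simp: successively_append_iff)
      moreover have "distinct (xs @ k # ks)" "set (xs @ k # ks) = S"
        using xs ks k(1) KS by auto
      ultimately show ?thesis by blast
    qed
  qed
qed

text \<open>The elements with \<open>t\<close> among their powers are joined to none of the others, so they may be
  inserted anywhere into a path through the latter; exchanging \<open>s\<close> and \<open>t\<close> one may assume that
  there are not too many of them.\<close>

theorem hamiltonian_path_two_subgroups: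
  assumes s: "s \<in> carrier G" "ord s = p" and t: "t \<in> carrier G" "ord t = p"
    and st: "t \<notin> generate G {s}"
  shows "\<exists>xs. distinct xs \<and> set xs = carrier G - {\<one>} \<and> successively (\<lambda>a b. \<not> comparable a b) xs"
proof -
  define above where "above t = {a \<in> carrier G. t \<in> generate G {a}}" for t
  have finab: "finite (above t)" for t using fin by (simp add: above_def)
  have *: ?thesis if s: "s \<in> carrier G" "ord s = p" and t: "t \<in> carrier G" "ord t = p"
    and st: "t \<notin> generate G {s}" and le: "card (above t) \<le> card (above s)" for s t
  proof -
    have ne1: "u \<noteq> \<one>" if "ord u = p" for u using that prime_gt_1_nat[OF p] by auto
    have "above s \<subseteq> avoids t"
    proof
      fix a assume "a \<in> above s"
      then have a: "a \<in> carrier G" "s \<in> generate G {a}" by (auto simp: above_def)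
      have "a \<noteq> \<one>"
        using a(2) ne1[OF s(2)] by (auto simp: generate_eq_nat_pows[OF fin])
      moreover have "t \<notin> generate G {a}"
        using order_p_below[OF a(1) t _ a(2)] ne1[OF s(2)] st by blast
      ultimately show "a \<in> avoids t" using a by (simp add: avoids_def)
    qed
    moreover have finav: "finite (avoids t)" using fin by (simp add: avoids_def)
    ultimately have le': "card (above t) \<le> card (avoids t)"
      using le card_mono[of "avoids t" "above s"] by linarith
    obtain ys where ys: "distinct ys" "set ys = avoids t"
        "successively (\<lambda>a b. \<not> comparable a b) ys"
      using avoids_path[OF t order_refl] avoids_shift[OF t] by blast
    obtain xs where xs: "distinct xs" "set xs = above t"
      using finite_distinct_list[OF finab] by metis
    have nc: "\<not> comparable a b \<and> \<not> comparable b a" if "a \<in> above t" "b \<in> avoids t" for a b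
      using above_avoids_incomparable[OF t that(2)] that(1) comparable_sym
      by (auto simp: above_def)
    have "length xs \<le> length ys"
      using le' distinct_card[OF xs(1)] distinct_card[OF ys(1)] xs ys by simp
    then have "successively (\<lambda>a b. \<not> comparable a b) (splice ys xs)"
      using successively_splice[OF ys(3), of xs] nc xs ys by blast
    moreover have "distinct (splice ys xs)"
      using distinct_disjoint_shuffles[OF ys(1) xs(1) _ splice_in_shuffles] xs ys
      by (auto simp: above_def avoids_def)
    moreover have "\<one> \<notin> above t"
      using ne1[OF t(2)] by (auto simp: above_def generate_eq_nat_pows[OF fin])
    then have "set (splice ys xs) = carrier G - {\<one>}"
      using set_shuffles[OF splice_in_shuffles[of ys xs]] xs ys
      by (auto simp: above_def avoids_def)
    ultimately show ?thesis by blast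
  qed
  have ts: "s \<notin> generate G {t}"
    using generate_order_p[OF t] st s prime_gt_1_nat[OF p] by fastforce
  show ?thesis
    using *[OF s t st] *[OF t s ts] linear by blast
qed

end

section \<open>\<open>p\<close>-groups with a unique subgroup of order \<open>p\<close>\<close>

text \<open>Orbits have \<open>p\<close>-power size, so without a fixed point all of them would have size divisible by
  \<open>p\<close>.\<close>

lemma group_action_fixed_point:
  assumes act: "group_action G E \<phi>" and p: "prime p" "order G = p ^ n"
    and F: "F \<subseteq> E" "finite F" "\<not> p dvd card F"
    and inv: "\<And>g x. g \<in> carrier G \<Longrightarrow> x \<in> F \<Longrightarrow> \<phi> g x \<in> F"
  shows "\<exists>x\<in>F. \<forall>g\<in>carrier G. \<phi> g x = x"
proof (rule ccontr)
  assume no: "\<not> ?thesis"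
  interpret group_action G E \<phi> by fact
  have self: "x \<in> orbit G \<phi> x" if "x \<in> F" for x using orbit_refl that F(1) by blast
  have sub: "orbit G \<phi> x \<subseteq> F" if "x \<in> F" for x using inv that by (auto simp: orbit_def)
  have "p dvd card (\<Union> (orbit G \<phi> ` F))"
  proof (rule dvd_partition)
    show "finite (\<Union> (orbit G \<phi> ` F))" using sub F(2) by (meson UN_least finite_subset)
    show "\<forall>c\<in>orbit G \<phi> ` F. p dvd card c"
    proof
      fix c assume "c \<in> orbit G \<phi> ` F"
      then obtain x where x: "x \<in> F" "c = orbit G \<phi> x" by blast
      then obtain g where g: "g \<in> carrier G" "\<phi> g x \<noteq> x" using no by blast
      then have "\<phi> g x \<in> c" by (auto simp: x(2) orbit_def)
      then have "card c \<noteq> 1" using self[OF x(1)] g(2) x(2) by (auto simp: card_1_singleton_iff)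
      moreover have "card c dvd p ^ n"
        using orbit_stabilizer_theorem[of x] x F(1) p(2) by (metis dvd_triv_left subsetD)
      then obtain k where "card c = p ^ k" using divides_primepow_nat[OF p(1)] by blast
      ultimately show "p dvd card c" by (cases k) auto
    qed
    show "\<forall>c1\<in>orbit G \<phi> ` F. \<forall>c2\<in>orbit G \<phi> ` F. c1 \<noteq> c2 \<longrightarrow> c1 \<inter> c2 = {}"
    proof (intro ballI impI)
      fix c1 c2 assume "c1 \<in> orbit G \<phi> ` F" "c2 \<in> orbit G \<phi> ` F" "c1 \<noteq> c2"
      then show "c1 \<inter> c2 = {}"
        using disjoint_union[of c1 c2] F(1) by (auto simp: orbits_def)
    qed
  qed
  moreover have "\<Union> (orbit G \<phi> ` F) = F" using self sub by blast
  ultimately show False using F(3) by simp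
qed

lemma geometric_sum_mod_square:
  fixes w :: int
  shows "(P::int)^2 dvd (1 + P * w) ^ l - (1 + int l * P * w)"
proof (induction l)
  case (Suc l)
  have "(1 + P * w) ^ Suc l - (1 + int (Suc l) * P * w)
    = (1 + P * w) * ((1 + P * w) ^ l - (1 + int l * P * w)) + P^2 * (int l * w^2)"
    by (simp add: algebra_simps power2_eq_square)
  then show ?case using Suc by simp
qed simp

text \<open>Write \<open>N\<close> for the sum. The equation \<open>i N + j \<equiv> 0\<close> modulo \<open>p^m\<close> is unsolvable in \<open>i\<close>, so \<open>j\<close> is
  divisible by a smaller power of \<open>p\<close> than \<open>N\<close> and \<open>p^m\<close> are, and then \<open>j (r - 1) \<equiv> 0\<close> forces
  \<open>r \<equiv> 1\<close> modulo \<open>p\<close>. If \<open>p\<close> is odd, this gives \<open>N \<equiv> p\<close> modulo \<open>p^2\<close>, so \<open>j\<close> is prime to \<open>p\<close> and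
  \<open>r \<equiv> 1\<close> modulo \<open>p^m\<close>. For \<open>p = 2\<close> the sum is \<open>r + 1\<close>, which allows \<open>r \<equiv> -1\<close> as well.\<close>

lemma norm_dichotomy:
  fixes p m :: nat and r j :: int
  assumes p: "prime p" and stable: "int p ^ m dvd j * (r - 1)"
    and unsolvable: "\<not> gcd (\<Sum>l<p. r ^ l) (int p ^ m) dvd j"
  shows "(int p ^ m dvd r - 1 \<and> \<not> int p dvd j) \<or> (p = 2 \<and> 2 \<le> m \<and> 2 ^ m dvd r + 1)"
proof -
  define P where "P = int p"
  define N where "N = (\<Sum>l<p. r ^ l)"
  have P: "prime P" using p by (simp add: P_def)
  obtain \<alpha> where \<alpha>: "\<alpha> \<le> m" "gcd N (P ^ m) = P ^ \<alpha>"
    using divides_primepow[OF P, of "gcd N (P ^ m)" m] by (auto simp: P_def)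
  have j0: "j \<noteq> 0" using unsolvable by auto
  define \<beta> where "\<beta> = multiplicity P j"
  obtain j' where j': "j = P ^ \<beta> * j'" "\<not> P dvd j'"
    using multiplicity_decompose'[of j P] j0 P not_prime_unit unfolding \<beta>_def by metis
  have "\<beta> < \<alpha>"
  proof (rule ccontr)
    assume "\<not> \<beta> < \<alpha>"
    then have "P ^ \<alpha> dvd j" using j' by (simp add: le_imp_power_dvd)
    then show False using unsolvable \<alpha>(2) by (simp add: N_def P_def)
  qed
  then have bm: "\<beta> < m" using \<alpha>(1) by simp
  have "P ^ \<beta> * P ^ (m - \<beta>) dvd P ^ \<beta> * (j' * (r - 1))"
    using stable bm j'(1) by (simp add: P_def mult.assoc flip: power_add)
  then have "P ^ (m - \<beta>) dvd j' * (r - 1)" using P by (simp add: prime_gt_0_int)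
  moreover have "coprime (P ^ (m - \<beta>)) j'"
    using j'(2) P by (simp add: prime_imp_coprime)
  ultimately have r1: "P ^ (m - \<beta>) dvd r - 1" by (simp add: coprime_dvd_mult_right_iff)
  show ?thesis
  proof (cases "\<alpha> = 1")
    case True
    then have "\<beta> = 0" using \<open>\<beta> < \<alpha>\<close> by simp
    then show ?thesis using r1 j' by (simp add: P_def)
  next
    case False
    then have "2 \<le> \<alpha>" using \<open>\<beta> < \<alpha>\<close> by simp
    then have PN: "P^2 dvd N" using \<alpha>(2) by (metis dvd_trans gcd_dvd1 le_imp_power_dvd)
    have "P dvd P ^ (m - \<beta>)" using bm by simp
    then obtain w where "r - 1 = P * w" using r1 by (meson dvd_def dvd_trans)
    then have r: "r = 1 + P * w" by simp
    have p2: "p = 2"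
    proof (rule ccontr)
      assume "p \<noteq> 2"
      then have "odd p" using p primes_dvd_imp_eq two_is_prime_nat by blast
      then obtain q where q: "p = 2 * q + 1" by (rule oddE)
      have "P^2 dvd (\<Sum>l<p. r ^ l - (1 + int l * P * w))"
        unfolding r by (intro dvd_sum geometric_sum_mod_square)
      also have "(\<Sum>l<p. r ^ l - (1 + int l * P * w)) = N - P - P * w * (\<Sum>l<p. int l)"
        by (simp add: N_def sum_subtractf sum.distrib sum_distrib_left P_def algebra_simps)
      also have "(\<Sum>l<p. int l) = P * int q"
      proof -
        have "2 * (\<Sum>l<n. int l) = int n * (int n - 1)" for n
          by (induction n) (auto simp: algebra_simps)
        from this[of p] show ?thesis using q by (simp add: P_def algebra_simps)
      qed
      finally have "P^2 dvd N - P - P * w * (P * int q)" .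
      moreover have "P * w * (P * int q) = P^2 * (w * int q)"
        by (simp add: power2_eq_square)
      ultimately have "P^2 dvd N - P" by (metis diff_add_cancel dvd_add dvd_triv_left)
      then have "P^2 dvd P" using PN by (metis dvd_diff_right_iff)
      then have "P dvd 1" using P by (simp add: power2_eq_square prime_gt_0_int)
      then show False using P not_prime_unit by blast
    qed
    then have N2: "N = 1 + r" by (simp add: N_def numeral_2_eq_2)
    have "m - \<beta> \<le> 1"
    proof (rule ccontr)
      assume "\<not> m - \<beta> \<le> 1"
      then have "P^2 dvd r - 1" using r1 by (metis dvd_trans le_imp_power_dvd not_less_eq_eq one_add_one plus_1_eq_Suc)
      then have "4 dvd r - 1" "4 dvd r + 1" using PN N2 p2 by (auto simp: P_def add.commute)
      then show False by presburger
    qed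
    then have "\<alpha> = m" using \<open>\<beta> < \<alpha>\<close> \<alpha>(1) by simp
    then have "P ^ m dvd N" using \<alpha>(2) by (metis gcd_dvd1)
    then show ?thesis using N2 p2 \<open>\<alpha> = m\<close> \<open>2 \<le> \<alpha>\<close> by (simp add: P_def add.commute)
  qed
qed

context group
begin

lemma conj_nat_pow:
  assumes "g \<in> carrier G" "x \<in> carrier G"
  shows "(g \<otimes> x \<otimes> inv g) [^] (n::nat) = g \<otimes> x [^] n \<otimes> inv g"
proof (induction n)
  case (Suc n)
  then show ?case using assms by (simp add: m_assoc) (simp add: inv_solve_left flip: m_assoc)
qed (use assms in simp)

lemma semicommute_pow_right:
  assumes "g \<in> carrier G" "a \<in> carrier G" "g \<otimes> a = a [^] (r::nat) \<otimes> g"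
  shows "g \<otimes> a [^] (i::nat) = a [^] (i * r) \<otimes> g"
proof (induction i)
  case (Suc i)
  have "g \<otimes> a [^] Suc i = (g \<otimes> a [^] i) \<otimes> a" using assms by (simp add: m_assoc)
  also have "\<dots> = a [^] (i * r) \<otimes> (g \<otimes> a)" using assms Suc by (simp add: m_assoc)
  also have "\<dots> = a [^] (Suc i * r) \<otimes> g"
    using assms by (simp add: nat_pow_mult add.commute flip: m_assoc)
  finally show ?case .
qed (use assms in simp)

lemma semicommute_pow_left:
  assumes "g \<in> carrier G" "a \<in> carrier G" "g \<otimes> a = a [^] (r::nat) \<otimes> g"
  shows "g [^] (n::nat) \<otimes> a [^] (i::nat) = a [^] (i * r ^ n) \<otimes> g [^] n"
proof (induction n arbitrary: i)
  case (Suc n)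
  have "g [^] Suc n \<otimes> a [^] i = g [^] n \<otimes> (g \<otimes> a [^] i)" using assms by (simp add: m_assoc)
  also have "\<dots> = (g [^] n \<otimes> a [^] (i * r)) \<otimes> g"
    using assms semicommute_pow_right[OF assms, of i] by (simp add: m_assoc)
  also have "\<dots> = a [^] (i * r ^ Suc n) \<otimes> g [^] Suc n"
    using assms Suc[of "i * r"] by (simp add: m_assoc mult.assoc)
  finally show ?case .
qed (use assms in simp)

lemma semicommute_mult_pow:
  assumes "g \<in> carrier G" "a \<in> carrier G" "g \<otimes> a = a [^] (r::nat) \<otimes> g"
  shows "(a [^] (i::nat) \<otimes> g) [^] (n::nat) = a [^] (i * (\<Sum>l<n. r ^ l)) \<otimes> g [^] n"
proof (induction n)
  case (Suc n)
  let ?S = "\<Sum>l<n. r ^ l"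
  have "(a [^] i \<otimes> g) [^] Suc n = a [^] (i * ?S) \<otimes> (g [^] n \<otimes> a [^] i) \<otimes> g"
    using assms Suc by (simp add: m_assoc)
  also have "\<dots> = a [^] (i * ?S) \<otimes> (a [^] (i * r ^ n) \<otimes> g [^] n) \<otimes> g"
    by (simp only: semicommute_pow_left[OF assms])
  also have "\<dots> = a [^] (i * (\<Sum>l<Suc n. r ^ l)) \<otimes> g [^] Suc n"
    using assms by (simp add: m_assoc distrib_left flip: nat_pow_mult)
  finally show ?case .
qed (use assms in simp)

end

context prime_power_group
begin

text \<open>With \<open>N = 1 + r + \<dots> + r^(p - 1)\<close> one has \<open>(a^i g)^p = a^(i N + j)\<close>. If some exponent \<open>i\<close> makes this
  trivial, then \<open>a^i g\<close> generates a second subgroup of order \<open>p\<close>; that none does leaves only two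
  possibilities for the action of \<open>g\<close> on \<open>a\<close>.\<close>

lemma cyclic_extension_dichotomy:
  assumes uniq: "\<And>u v. u \<in> carrier G \<Longrightarrow> v \<in> carrier G \<Longrightarrow> ord u = p \<Longrightarrow> ord v = p \<Longrightarrow> v \<in> generate G {u}"
    and a: "a \<in> carrier G" "ord a = p ^ m" "1 \<le> m"
    and g: "g \<in> carrier G" "g \<notin> generate G {a}"
    and r: "g \<otimes> a = a [^] (r::nat) \<otimes> g" and j: "g [^] p = a [^] (j::nat)"
  shows "(g \<otimes> a = a \<otimes> g \<and> \<not> p dvd j) \<or> (p = 2 \<and> 2 \<le> m \<and> g \<otimes> a = inv a \<otimes> g)"
proof -
  let ?N = "\<Sum>l<p. r ^ l"
  have eq: "a [^] k = a [^] l \<longleftrightarrow> int p ^ m dvd int l - int k" for k l :: nat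
    using int_pow_eq[OF a(1), of "int k" "int l"] a(2) by (simp add: int_pow_int)
  have "g \<otimes> a [^] j = a [^] j \<otimes> g"
    using j g(1) by (metis nat_pow_Suc nat_pow_Suc2)
  then have "a [^] (j * r) \<otimes> g = a [^] j \<otimes> g"
    using semicommute_pow_right[OF g(1) a(1) r, of j] by simp
  then have "a [^] j = a [^] (j * r)" using a g by simp
  then have stable: "int p ^ m dvd int j * (int r - 1)"
    unfolding eq by (simp add: algebra_simps)
  have unsolvable: "\<not> gcd (\<Sum>l<p. int r ^ l) (int p ^ m) dvd int j"
  proof
    assume "gcd (\<Sum>l<p. int r ^ l) (int p ^ m) dvd int j"
    then have gj: "gcd ?N (ord a) dvd j"
      using a(2) by (metis (mono_tags, lifting) gcd_int_int_eq int_dvd_int_iff of_nat_power of_nat_sum sum.cong)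
    have "\<exists>i::nat. a [^] (i * ?N) = inv (a [^] j)"
    proof -
      have "a [^] j \<in> generate G {a [^] ?N}"
        using pow_in_generate_pow[OF fin a(1) gj] .
      then have "inv (a [^] j) \<in> generate G {a [^] ?N}"
        by (rule generate_inv[rotated]) (use a in simp)
      then obtain i :: nat where "inv (a [^] j) = (a [^] ?N) [^] i"
        using generate_eq_nat_pows[OF fin, of "a [^] ?N"] a by auto
      then show ?thesis using a by (intro exI[of _ i]) (simp add: nat_pow_pow mult.commute)
    qed
    then obtain i :: nat where i: "a [^] (i * ?N) = inv (a [^] j)" by blast
    \<comment> \<open>Then \<open>u\<close> is an element of order \<open>p\<close> outside the cyclic subgroup, which contains one as well.\<close>
    define u where "u = a [^] i \<otimes> g"
    have uc: "u \<in> carrier G" using a g by (simp add: u_def)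
    have "u [^] p = \<one>"
      unfolding u_def semicommute_mult_pow[OF g(1) a(1) r] i j using a by simp
    moreover have u_notin: "u \<notin> generate G {a}"
    proof
      assume "u \<in> generate G {a}"
      then have "inv (a [^] i) \<otimes> u \<in> generate G {a}"
        using a(1) generate_pow_in by (intro generate_mult generate_inv)
      then show False using g a by (simp add: u_def flip: m_assoc)
    qed
    moreover have "u \<noteq> \<one>" using u_notin generate.one by metis
    ultimately have "ord u = p"
      using pow_eq_id[OF uc, of p] ord_eq_1[OF uc] p by (auto simp: prime_nat_iff)
    moreover have "ord (a [^] (p ^ (m - 1))) = p"
      using ord_pow[OF a(1), of "p ^ (m - 1)"] a p
      by (cases m) (auto simp: prime_gt_0_nat)
    ultimately have "u \<in> generate G {a [^] (p ^ (m - 1))}"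
      using uniq[of "a [^] (p ^ (m - 1))" u] uc a by simp
    then show False
      using generate_mono_mem[OF a(1) generate_pow_in[OF a(1)]] u_notin by blast
  qed
  show ?thesis
    using norm_dichotomy[OF p stable unsolvable]
  proof (elim disjE conjE)
    assume *: "int p ^ m dvd int r - 1" "\<not> int p dvd int j"
    then have "a [^] (1::nat) = a [^] r" unfolding eq by simp
    then show ?thesis using r a * by auto
  next
    assume *: "p = 2" "2 \<le> m" "2 ^ m dvd int r + 1"
    then have "a [^] (0::nat) = a [^] (r + 1)" unfolding eq by (simp add: add.commute)
    then have "a [^] r \<otimes> a = \<one>" using a by simp
    then have "a [^] r = inv a" using a by (simp add: inv_equality)
    then show ?thesis using r * by simp
  qed
qed

lemma last_power_outside:
  assumes H: "subgroup H G" and x: "x \<in> carrier G" "x \<notin> H"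
  shows "\<exists>n. x [^] (p ^ n) \<notin> H \<and> (x [^] (p ^ n)) [^] p \<in> H"
proof -
  obtain k where "ord x = p ^ k" using ord_p_power[OF x(1)] by blast
  then have k: "x [^] (p ^ k) \<in> H" using x(1) H by (metis pow_ord_eq_1 subgroup.one_closed)
  define n where "n = (LEAST n. x [^] (p ^ n) \<in> H)"
  have n: "x [^] (p ^ n) \<in> H" unfolding n_def using k by (rule LeastI)
  then have "n \<noteq> 0" using x by (auto intro: ccontr)
  then obtain n' where n': "n = Suc n'" by (cases n) auto
  have "x [^] (p ^ n') \<notin> H" using not_less_Least[of n' "\<lambda>n. x [^] (p ^ n) \<in> H"] n' n_def by simp
  moreover have "(x [^] (p ^ n')) [^] p = x [^] (p ^ n)"
    using x(1) n' by (simp add: nat_pow_pow mult.commute)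
  ultimately show ?thesis using n by metis
qed

text \<open>The cosets of \<open>\<langle>a\<rangle>\<close> other than itself in its centralizer number one less than a power of
  \<open>p\<close>, so conjugation fixes one of them.\<close>

lemma centralizer_central_coset:
  assumes a: "a \<in> carrier G" "\<And>g. g \<in> carrier G \<Longrightarrow> g \<otimes> a \<otimes> inv g \<in> generate G {a}"
    and c: "c \<in> carrier G" "c \<otimes> a = a \<otimes> c" "c \<notin> generate G {a}"
  shows "\<exists>g\<in>carrier G. g \<otimes> a = a \<otimes> g \<and> g \<notin> generate G {a} \<and>
    (\<forall>h\<in>carrier G. h \<otimes> g \<otimes> inv h \<in> generate G {a} #> g)"
proof -
  let ?A = "generate G {a}"
  define Z where "Z = {x \<in> carrier G. x \<otimes> a = a \<otimes> x}"
  have sA: "subgroup ?A G" using a by (intro generate_is_subgroup) auto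
  have nA: "?A \<lhd> G"
    unfolding normal_inv_iff
  proof (intro conjI ballI)
    fix x u assume x: "x \<in> carrier G" and "u \<in> ?A"
    then obtain i :: nat where "u = a [^] i" using generate_eq_nat_pows[OF fin a(1)] by auto
    then have "x \<otimes> u \<otimes> inv x = (x \<otimes> a \<otimes> inv x) [^] i" using conj_nat_pow[OF x a(1)] by simp
    then show "x \<otimes> u \<otimes> inv x \<in> ?A"
      using generate_pow_in[of "x \<otimes> a \<otimes> inv x" i] generate_mono_mem[OF a(1) a(2)[OF x]] x a(1)
      by auto
  qed (rule sA)
  have Zcomm: "x \<otimes> u = u \<otimes> x" if xZ: "x \<in> Z" and uA: "u \<in> ?A" for x u
  proof -
    obtain i :: nat where i: "u = a [^] i" using generate_eq_nat_pows[OF fin a(1)] uA by auto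
    have "x \<otimes> a = a [^] (1::nat) \<otimes> x" using xZ a(1) by (simp add: Z_def)
    from semicommute_pow_right[OF _ a(1) this, of i] show ?thesis using i xZ by (simp add: Z_def)
  qed
  have sZ: "subgroup Z G"
  proof (rule subgroupI)
    show "Z \<subseteq> carrier G" "Z \<noteq> {}" using a by (auto simp: Z_def)
    show "inv x \<in> Z" if "x \<in> Z" for x
      using that a(1) by (simp add: Z_def) (metis inv_closed inv_solve_left inv_solve_right m_assoc m_closed)
    show "x \<otimes> y \<in> Z" if "x \<in> Z" "y \<in> Z" for x y
      using that a(1) by (simp add: Z_def) (metis m_assoc)
  qed
  have AZ: "?A \<subseteq> Z"
  proof
    fix u assume "u \<in> ?A"
    moreover have "a \<in> Z" using a(1) by (simp add: Z_def)
    ultimately show "u \<in> Z" using Zcomm[of a u] generate_sub[OF a(1)] by (auto simp: Z_def)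
  qed
  have Znorm: "h \<otimes> x \<otimes> inv h \<in> Z" if h: "h \<in> carrier G" and x: "x \<in> Z" for h x
  proof -
    have xc: "x \<in> carrier G" using x by (simp add: Z_def)
    let ?b = "inv h \<otimes> a \<otimes> h"
    have b: "?b \<in> ?A" using a(2)[of "inv h"] h by simp
    have "h \<otimes> x \<otimes> inv h \<otimes> a = h \<otimes> (x \<otimes> ?b) \<otimes> inv h"
      using h xc a(1) by (simp add: m_assoc)
    also have "\<dots> = h \<otimes> (?b \<otimes> x) \<otimes> inv h" using Zcomm[OF x b] by simp
    also have "\<dots> = a \<otimes> (h \<otimes> x \<otimes> inv h)"
      using h xc a(1) by (simp flip: m_assoc)
    finally show ?thesis using h xc by (simp add: Z_def)
  qed
  define F where "F = (\<lambda>x. ?A #> x) ` (Z - ?A)"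
  have Zc: "Z \<subseteq> carrier G" by (auto simp: Z_def)
  let ?\<phi> = "\<lambda>g. \<lambda>H \<in> {H. H \<subseteq> carrier G}. g <# H #> inv g"
  have act: "?\<phi> h (?A #> x) = ?A #> (h \<otimes> x \<otimes> inv h)" if "h \<in> carrier G" "x \<in> carrier G" for h x
  proof -
    have Ac: "?A \<subseteq> carrier G" by (rule generate_sub[OF a(1)])
    have "h <# (?A #> x) #> inv h = (h <# ?A #> x) #> inv h"
      using coset_assoc[OF that(1,2) Ac] by simp
    also have "h <# ?A = ?A #> h" using normal.coset_eq[OF nA] that(1) by simp
    also have "?A #> h #> x #> inv h = ?A #> (h \<otimes> x \<otimes> inv h)"
      using that Ac by (simp add: coset_mult_assoc)
    finally show ?thesis using r_coset_subset_G[OF Ac that(2)] by simp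
  qed
  have "\<exists>K\<in>F. \<forall>h\<in>carrier G. ?\<phi> h K = K"
  proof -
    obtain n where n: "order G = p ^ n" using order_p_power by blast
    have finF: "finite F" using fin Zc by (auto simp: F_def intro: finite_subset)
    have "\<not> p dvd card F"
    proof -
      let ?H = "G\<lparr>carrier := Z\<rparr>"
      have gH: "group ?H" using sZ by (rule subgroup_imp_group)
      have sAH: "subgroup ?A ?H" using subgroup_incl[OF sA sZ AZ] .
      have rc: "rcosets\<^bsub>?H\<^esub> ?A = (\<lambda>x. ?A #> x) ` Z" by (auto simp: RCOSETS_def r_coset_def)
      have lag: "card ((\<lambda>x. ?A #> x) ` Z) * card ?A = card Z"
        using group.lagrange[OF gH sAH] unfolding rc order_def by simp
      have "card Z dvd p ^ n" using lagrange[OF sZ] n by (metis dvd_triv_right)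
      then obtain z where "card Z = p ^ z" using divides_primepow_nat[OF p] by blast
      then obtain d where d: "card ((\<lambda>x. ?A #> x) ` Z) = p ^ d"
        using lag divides_primepow_nat[OF p] by (metis dvd_triv_left)
      have "(\<lambda>x. ?A #> x) ` Z = insert ?A F"
      proof -
        have inA: "?A #> x = ?A" if "x \<in> ?A" for x
          using coset_join2[OF _ sA that] generate_sub[OF a(1)] that by blast
        have "?A = ?A #> \<one>" using inA[OF generate.one] by simp
        moreover have "\<one> \<in> Z" using AZ generate.one by blast
        ultimately have "?A \<in> (\<lambda>x. ?A #> x) ` Z" by (rule image_eqI)
        moreover have "(\<lambda>x. ?A #> x) ` Z \<subseteq> insert ?A F" using inA by (auto simp: F_def)
        moreover have "F \<subseteq> (\<lambda>x. ?A #> x) ` Z" by (auto simp: F_def)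
        ultimately show ?thesis by blast
      qed
      moreover have "?A \<notin> F"
      proof
        assume "?A \<in> F"
        then obtain x where "x \<in> Z" "x \<notin> ?A" "?A = ?A #> x" by (auto simp: F_def)
        then show False using rcos_self[OF _ sA, of x] Zc by blast
      qed
      ultimately have dF: "p ^ d = card F + 1" using d finF by simp
      have "F \<noteq> {}" using c by (auto simp: F_def Z_def)
      then have "d \<noteq> 0" using dF finF by (cases d) auto
      then have "p dvd card F + 1" using dF by (metis dvd_power_iff_le dvd_power neq0_conv)
      then show ?thesis using p by (metis dvd_add_right_iff not_prime_unit)
    qed
    moreover have "?\<phi> h K \<in> F" if h: "h \<in> carrier G" and K: "K \<in> F" for h K
    proof -
      obtain x where x: "x \<in> Z" "x \<notin> ?A" "K = ?A #> x" using K by (auto simp: F_def)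
      have xc: "x \<in> carrier G" using x Zc by blast
      have "h \<otimes> x \<otimes> inv h \<notin> ?A"
      proof
        assume "h \<otimes> x \<otimes> inv h \<in> ?A"
        then have "inv h \<otimes> (h \<otimes> x \<otimes> inv h) \<otimes> h \<in> ?A"
          using normal.inv_op_closed1[OF nA h] by simp
        moreover have "inv h \<otimes> (h \<otimes> x \<otimes> inv h) \<otimes> h = x"
          using h xc by (simp add: m_assoc) (simp flip: m_assoc)
        ultimately show False using x by simp
      qed
      then show ?thesis using act[OF h xc] Znorm[OF h x(1)] x(3) by (auto simp: F_def)
    qed
    moreover have "F \<subseteq> {H. H \<subseteq> carrier G}"
      using r_coset_subset_G[OF generate_sub[OF a(1)]] Zc by (auto simp: F_def)
    ultimately show ?thesis
      by (intro group_action_fixed_point[OF action_by_conjugation_on_power_set p n _ finF])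
  qed
  then obtain g where g: "g \<in> Z" "g \<notin> ?A" "\<forall>h\<in>carrier G. ?\<phi> h (?A #> g) = ?A #> g"
    by (auto simp: F_def)
  have gc: "g \<in> carrier G" using g Zc by blast
  have "h \<otimes> g \<otimes> inv h \<in> ?A #> g" if h: "h \<in> carrier G" for h
    using rcos_self[OF _ sA, of "h \<otimes> g \<otimes> inv h"] act[OF h gc] g(3) h gc by simp
  then show ?thesis using g(1,2) by (auto simp: Z_def)
qed

text \<open>A maximal normal cyclic subgroup is its own centralizer: an element of the centralizer that is
  central modulo \<open>\<langle>a\<rangle>\<close> would generate, together with \<open>a\<close>, a larger normal cyclic subgroup.\<close>

lemma max_normal_cyclic_self_centralizing:
  assumes uniq: "\<And>u v. u \<in> carrier G \<Longrightarrow> v \<in> carrier G \<Longrightarrow> ord u = p \<Longrightarrow> ord v = p \<Longrightarrow> v \<in> generate G {u}"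
    and a: "a \<in> carrier G" "\<And>g. g \<in> carrier G \<Longrightarrow> g \<otimes> a \<otimes> inv g \<in> generate G {a}" "a \<noteq> \<one>"
    and max: "\<And>b. b \<in> carrier G \<Longrightarrow> (\<And>g. g \<in> carrier G \<Longrightarrow> g \<otimes> b \<otimes> inv g \<in> generate G {b}) \<Longrightarrow> ord b \<le> ord a"
    and c: "c \<in> carrier G" "c \<otimes> a = a \<otimes> c"
  shows "c \<in> generate G {a}"
proof (rule ccontr)
  assume "c \<notin> generate G {a}"
  let ?A = "generate G {a}"
  have sA: "subgroup ?A G" using a by (intro generate_is_subgroup) auto
  have Ac: "?A \<subseteq> carrier G" by (rule generate_sub[OF a(1)])
  obtain g0 where g0: "g0 \<in> carrier G" "g0 \<otimes> a = a \<otimes> g0" "g0 \<notin> ?A"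
      "\<And>h. h \<in> carrier G \<Longrightarrow> h \<otimes> g0 \<otimes> inv h \<in> ?A #> g0"
    using centralizer_central_coset[OF a(1,2) c \<open>c \<notin> ?A\<close>] by blast
  obtain n where n: "g0 [^] (p ^ n) \<notin> ?A" "(g0 [^] (p ^ n)) [^] p \<in> ?A"
    using last_power_outside[OF sA g0(1,3)] by blast
  define g where "g = g0 [^] (p ^ n)"
  have gc: "g \<in> carrier G" using g0(1) by (simp add: g_def)
  have comm0: "u \<otimes> g0 = g0 \<otimes> u" if uA: "u \<in> ?A" for u
  proof -
    obtain i :: nat where "u = a [^] i" using generate_eq_nat_pows[OF fin a(1)] uA by auto
    then show ?thesis
      using semicommute_pow_right[OF g0(1) a(1), of 1 i] g0(2) a(1) by simp
  qed
  have ga: "g \<otimes> a = a \<otimes> g"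
    using semicommute_pow_left[OF g0(1) a(1), of 1 "p ^ n" 1] g0(2) a(1) by (simp add: g_def)
  obtain j :: nat where j: "g [^] p = a [^] j"
    using n(2) generate_eq_nat_pows[OF fin a(1)] unfolding g_def by auto
  obtain m where m: "ord a = p ^ m" using ord_p_power[OF a(1)] by blast
  have m1: "1 \<le> m" using a(1,3) m ord_eq_1[OF a(1)] by (cases m) auto
  have "\<not> p dvd j"
  proof -
    have "\<not> (p = 2 \<and> 2 \<le> m \<and> g \<otimes> a = inv a \<otimes> g)"
    proof
      assume *: "p = 2 \<and> 2 \<le> m \<and> g \<otimes> a = inv a \<otimes> g"
      then have "a = inv a" using ga gc a(1) by simp
      then have "a [^] (2::nat) = \<one>" using a(1) by (metis numeral_2_eq_2 nat_pow_Suc nat_pow_eone One_nat_def r_inv)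
      then have "2 ^ m dvd (2::nat)" using pow_eq_id[OF a(1), of 2] m * by simp
      then have "2 ^ m \<le> (2::nat)" by (rule dvd_imp_le) simp
      moreover have "(2::nat) ^ 2 \<le> 2 ^ m" using * by (intro power_increasing) auto
      ultimately show False by simp
    qed
    moreover have "g \<notin> ?A" using n(1) by (simp add: g_def)
    moreover have "g \<otimes> a = a [^] (1::nat) \<otimes> g" using ga a(1) by simp
    ultimately show ?thesis
      using cyclic_extension_dichotomy[OF uniq a(1) m m1 gc _ _ j] by blast
  qed
  then have "coprime (p ^ m) j" using p by (simp add: prime_imp_coprime)
  then have "gcd j (ord a) dvd 1"
    by (metis coprime_commute coprime_iff_gcd_eq_1 dvd_refl m)
  then have "a \<in> generate G {a [^] j}" using pow_in_generate_pow[OF fin a(1), of j 1] a(1) by simp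
  then have ag: "a \<in> generate G {g}"
    using generate_trans[OF gc] generate_pow_in[OF gc, of p] j by simp
  have "h \<otimes> g \<otimes> inv h \<in> generate G {g}" if h: "h \<in> carrier G" for h
  proof -
    obtain u where u: "u \<in> ?A" "h \<otimes> g0 \<otimes> inv h = u \<otimes> g0"
      using g0(4)[OF h] by (auto simp: r_coset_def)
    have uc: "u \<in> carrier G" using u Ac by blast
    have "h \<otimes> g \<otimes> inv h = (u \<otimes> g0) [^] (p ^ n)"
      using conj_nat_pow[OF h g0(1), of "p ^ n"] u(2) by (simp add: g_def)
    also have "\<dots> = u [^] (p ^ n) \<otimes> g"
      using pow_mult_distrib[OF comm0[OF u(1)] uc g0(1)] by (simp add: g_def)
    also have "\<dots> \<in> generate G {g}"
    proof -
      have "u \<in> generate G {g}" using generate_trans[OF gc u(1) ag] .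
      then have "u [^] (p ^ n) \<in> generate G {g}"
        using generate_trans[OF gc generate_pow_in[OF uc]] by blast
      then show ?thesis using generate_mult[OF gc] generate_self by blast
    qed
    finally show ?thesis .
  qed
  then have "ord g \<le> ord a" by (rule max[OF gc])
  then show False using generate_sym_if_ord_le[OF fin gc ag] n(1) by (simp add: g_def)
qed

end

definition (in group) quaternion_generators :: "nat \<Rightarrow> 'a \<Rightarrow> 'a \<Rightarrow> bool" where
  "quaternion_generators k a b \<longleftrightarrow> a \<in> carrier G \<and> b \<in> carrier G \<and> ord a = 2 ^ k \<and>
    b \<notin> generate G {a} \<and> b \<otimes> b = a [^] ((2::nat) ^ (k - 1)) \<and> inv b \<otimes> a \<otimes> b = inv a \<and>
    carrier G = generate G {a} \<union> (\<lambda>x. x \<otimes> b) ` generate G {a}"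

context prime_power_group
begin

text \<open>Let \<open>\<langle>a\<rangle>\<close> be a maximal normal cyclic subgroup. Being its own centralizer, it forces every \<open>g\<close>
  outside with \<open>g^p\<close> inside to invert \<open>a\<close>, and \<open>p = 2\<close>. Two such elements differ by an element of the
  centralizer, so they fill a single coset; nothing else is left outside, as \<open>-1\<close> is not a square
  modulo \<open>4\<close>.\<close>

theorem unique_subgroup_order_p:
  assumes uniq: "\<And>u v. u \<in> carrier G \<Longrightarrow> v \<in> carrier G \<Longrightarrow> ord u = p \<Longrightarrow> ord v = p \<Longrightarrow> v \<in> generate G {u}"
  shows "(\<exists>a\<in>carrier G. carrier G = generate G {a}) \<or>
    (p = 2 \<and> (\<exists>k\<ge>2. \<exists>a b. quaternion_generators k a b))"
proof (cases "carrier G = {\<one>}")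
  case True
  then have "carrier G = generate G {\<one>}"
    using generate_sub[of \<one>] generate.one[of G "{\<one>}"] by auto
  then show ?thesis by blast
next
  case False
  define nc where "nc a \<longleftrightarrow> a \<in> carrier G \<and> (\<forall>g\<in>carrier G. g \<otimes> a \<otimes> inv g \<in> generate G {a})" for a
  obtain x where x: "x \<in> carrier G" "x \<noteq> \<one>" using False by blast
  obtain k where k: "ord x = p ^ k" using ord_p_power[OF x(1)] by blast
  have "k \<noteq> 0" using x k ord_eq_1[OF x(1)] by (auto intro: ccontr)
  define c where "c = x [^] (p ^ (k - 1))"
  have c: "c \<in> carrier G" "ord c = p"
    using ord_pow[OF x(1), of "p ^ (k - 1)"] x k p \<open>k \<noteq> 0\<close>
    by (cases k; auto simp: c_def prime_gt_0_nat)+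
  have "nc c"
    unfolding nc_def
  proof (intro conjI ballI)
    fix g assume g: "g \<in> carrier G"
    have "(g \<otimes> c \<otimes> inv g) [^] p = \<one>"
      using conj_nat_pow[OF g c(1), of p] g c pow_ord_eq_1[OF c(1)] by simp
    then have "ord (g \<otimes> c \<otimes> inv g) dvd p" using pow_eq_id[of "g \<otimes> c \<otimes> inv g" p] g c by simp
    then consider "ord (g \<otimes> c \<otimes> inv g) = 1" | "ord (g \<otimes> c \<otimes> inv g) = p"
      using p by (auto simp: prime_nat_iff)
    then show "g \<otimes> c \<otimes> inv g \<in> generate G {c}"
    proof cases
      case 1
      then show ?thesis using ord_eq_1[of "g \<otimes> c \<otimes> inv g"] g c generate.one[of G] by simp
    next
      case 2
      then show ?thesis using uniq[of c] c g by simp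
    qed
  qed (rule c(1))
  have "\<exists>a. nc a \<and> (\<forall>b. nc b \<longrightarrow> ord b \<le> ord a)"
    using ex_has_greatest_nat[of nc c ord "Suc (order G)"] \<open>nc c\<close> ord_le_group_order[OF fin]
    by (auto simp: nc_def less_Suc_eq_le)
  then obtain a where "nc a" and amax: "\<And>b. nc b \<Longrightarrow> ord b \<le> ord a" by blast
  then have a: "a \<in> carrier G" "\<And>g. g \<in> carrier G \<Longrightarrow> g \<otimes> a \<otimes> inv g \<in> generate G {a}"
    by (auto simp: nc_def)
  let ?A = "generate G {a}"
  have sA: "subgroup ?A G" using a by (intro generate_is_subgroup) auto
  have Ac: "?A \<subseteq> carrier G" by (rule generate_sub[OF a(1)])
  have "p \<le> ord a" using amax[OF \<open>nc c\<close>] c by simp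
  then have "a \<noteq> \<one>" using prime_gt_1_nat[OF p] by auto
  have selfc: "c \<in> ?A" if "c \<in> carrier G" "c \<otimes> a = a \<otimes> c" for c
    by (rule max_normal_cyclic_self_centralizing[OF uniq a \<open>a \<noteq> \<one>\<close> amax that])
      (auto simp: nc_def)
  obtain m where m: "ord a = p ^ m" using ord_p_power[OF a(1)] by blast
  have m1: "1 \<le> m" using a(1) \<open>a \<noteq> \<one>\<close> m ord_eq_1[OF a(1)] by (cases m) auto
  have semi: "\<exists>r::nat. g \<otimes> a = a [^] r \<otimes> g" if g: "g \<in> carrier G" for g
  proof -
    obtain r :: nat where "g \<otimes> a \<otimes> inv g = a [^] r"
      using a(2)[OF g] generate_eq_nat_pows[OF fin a(1)] by auto
    then have "g \<otimes> a = a [^] r \<otimes> g" using g a(1) by (metis inv_closed inv_solve_right m_closed inv_inv nat_pow_closed)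
    then show ?thesis by blast
  qed
  have inverts: "p = 2 \<and> 2 \<le> m \<and> g \<otimes> a = inv a \<otimes> g"
    if g: "g \<in> carrier G" "g \<notin> ?A" "g [^] p \<in> ?A" for g
  proof -
    obtain r :: nat where r: "g \<otimes> a = a [^] r \<otimes> g" using semi[OF g(1)] by blast
    obtain j :: nat where j: "g [^] p = a [^] j"
      using g(3) generate_eq_nat_pows[OF fin a(1)] by auto
    show ?thesis
      using cyclic_extension_dichotomy[OF uniq a(1) m m1 g(1,2) r j] selfc[OF g(1)] g(2) by blast
  qed
  show ?thesis
  proof (cases "?A = carrier G")
    case True
    then show ?thesis using a(1) by blast
  next
    case False
    then obtain g0 where "g0 \<in> carrier G" "g0 \<notin> ?A" using Ac by blast
    then obtain b where b: "b \<in> carrier G" "b \<notin> ?A" "b [^] p \<in> ?A"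
      using last_power_outside[OF sA, of g0] by (metis nat_pow_closed)
    have p2: "p = 2" and m2: "2 \<le> m" and ba: "b \<otimes> a = inv a \<otimes> b" using inverts[OF b] by auto
    have bb: "b \<otimes> b \<in> ?A" using b(1,3) p2 by (simp add: numeral_2_eq_2)
    have coset: "h \<in> (\<lambda>x. x \<otimes> b) ` ?A" if h: "h \<in> carrier G" "h \<notin> ?A" for h
    proof -
      obtain n where n: "h [^] (p ^ n) \<notin> ?A" "(h [^] (p ^ n)) [^] p \<in> ?A"
        using last_power_outside[OF sA h] by blast
      have inv_n: "h [^] (p ^ n) \<otimes> a = inv a \<otimes> h [^] (p ^ n)"
        using inverts[OF _ n] h(1) by blast
      have "n = 0"
      proof (rule ccontr)
        assume "n \<noteq> 0"
        then obtain n' where n': "n = Suc n'" by (cases n) auto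
        define y where "y = h [^] (p ^ n')"
        have yc: "y \<in> carrier G" using h by (simp add: y_def)
        obtain s :: nat where s: "y \<otimes> a = a [^] s \<otimes> y" using semi[OF yc] by blast
        have hy: "h [^] (p ^ n) = y [^] (2::nat)"
          using h n' p2 by (simp add: y_def nat_pow_pow mult.commute)
        have "a [^] (s ^ 2) \<otimes> y [^] (2::nat) = inv a \<otimes> y [^] (2::nat)"
          using semicommute_pow_left[OF yc a(1) s, of 2 1] inv_n a(1) by (simp add: hy)
        then have "a [^] (s ^ 2) = inv a" using yc a(1) by simp
        then have "a [^] (s ^ 2 + 1) = \<one>" using a(1) by simp
        then have "2 ^ m dvd s ^ 2 + 1" using pow_eq_id[OF a(1)] m p2 by metis
        then have "2 ^ 2 dvd s ^ 2 + 1" using m2 by (metis dvd_trans le_imp_power_dvd)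
        then have "(s ^ 2 + 1) mod 4 = 0" by simp
        moreover have "(s ^ 2 + 1) mod 4 \<noteq> 0"
        proof (cases "even s")
          case True
          then obtain t where "s = 2 * t" by blast
          then have "s ^ 2 + 1 = 4 * t ^ 2 + 1" by (simp add: power2_eq_square)
          then show ?thesis by presburger
        next
          case False
          then obtain t where "s = 2 * t + 1" by (rule oddE)
          then have "s ^ 2 + 1 = 4 * (t ^ 2 + t) + 2" by (simp add: power2_eq_square algebra_simps)
          then show ?thesis by presburger
        qed
        ultimately show False by blast
      qed
      then have ha: "h \<otimes> a = inv a \<otimes> h" using inv_n h(1) by simp
      have hinv: "h \<otimes> inv a = a \<otimes> h"
        using ha h a(1) by (metis inv_closed inv_solve_left inv_solve_right m_assoc m_closed inv_inv)
      have "(h \<otimes> b) \<otimes> a = a \<otimes> (h \<otimes> b)"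
      proof -
        have "(h \<otimes> b) \<otimes> a = (h \<otimes> inv a) \<otimes> b" using h b a(1) ba by (simp add: m_assoc)
        then show ?thesis using h b a(1) hinv by (simp add: m_assoc)
      qed
      then have hb: "h \<otimes> b \<in> ?A" using selfc h b by simp
      have "h = (h \<otimes> b) \<otimes> inv (b \<otimes> b) \<otimes> b"
        using h b by (simp add: inv_mult_group m_assoc)
      moreover have "(h \<otimes> b) \<otimes> inv (b \<otimes> b) \<in> ?A"
        by (rule generate_mult[OF a(1) hb generate_inv[OF a(1) bb]])
      ultimately show ?thesis by blast
    qed
    have "b \<otimes> b = a [^] ((2::nat) ^ (m - 1))"
    proof -
      obtain j :: nat where j: "b \<otimes> b = a [^] j"
        using bb generate_eq_nat_pows[OF fin a(1)] by auto
      have "b \<otimes> a [^] j = inv (a [^] j) \<otimes> b"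
      proof -
        have "(b \<otimes> a \<otimes> inv b) [^] j = b \<otimes> a [^] j \<otimes> inv b" by (rule conj_nat_pow[OF b(1) a(1)])
        moreover have "b \<otimes> a \<otimes> inv b = inv a" using ba b a(1) by (simp add: m_assoc)
        ultimately have "inv (a [^] j) = b \<otimes> a [^] j \<otimes> inv b" using a(1) by (simp add: nat_pow_inv)
        then show ?thesis using a(1) b by (simp add: m_assoc)
      qed
      moreover have "b \<otimes> (b \<otimes> b) = (b \<otimes> b) \<otimes> b" using b by (simp add: m_assoc)
      ultimately have "inv (a [^] j) = a [^] j" using a(1) b(1) j by simp
      then have sq: "a [^] j \<otimes> a [^] j = \<one>" using a(1) by (metis nat_pow_closed r_inv)
      then have "a [^] (2 * j) = \<one>" using a(1) by (simp add: nat_pow_mult mult_2)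
      then have "2 ^ m dvd 2 * j" using pow_eq_id[OF a(1), of "2 * j"] m p2 by simp
      moreover have "(2::nat) ^ m = 2 * 2 ^ (m - 1)" using m1 by (cases m) auto
      ultimately have "2 ^ (m - 1) dvd j" by simp
      then obtain t where t: "j = 2 ^ (m - 1) * t" by blast
      \<comment> \<open>Otherwise \<open>b\<close> would be an involution outside \<open>\<langle>a\<rangle>\<close>.\<close>
      have "odd t"
      proof
        assume "even t"
        then have "2 ^ m dvd j" using t \<open>(2::nat) ^ m = 2 * 2 ^ (m - 1)\<close> by auto
        then have "b \<otimes> b = \<one>" using j pow_eq_id[OF a(1)] m p2 by simp
        then have "b [^] (2::nat) = \<one>" using b(1) by (simp add: numeral_2_eq_2)
        then have "ord b dvd 2" using pow_eq_id[OF b(1)] by simp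
        moreover have "b \<noteq> \<one>" using b(2) generate.one by metis
        ultimately have "ord b = p" using ord_eq_1[OF b(1)] p2 by (metis One_nat_def prime_nat_iff two_is_prime_nat)
        moreover have "ord (a [^] ((2::nat) ^ (m - 1))) = p"
          using ord_pow[OF a(1), of "2 ^ (m - 1)"] m p2 \<open>(2::nat) ^ m = 2 * 2 ^ (m - 1)\<close> by simp
        ultimately have "b \<in> generate G {a [^] ((2::nat) ^ (m - 1))}" using uniq a(1) b(1) by simp
        then show False
          using b(2) generate_trans[OF a(1) _ generate_pow_in[OF a(1)]] by blast
      qed
      then obtain q where "t = 2 * q + 1" by (rule oddE)
      then have "j = 2 ^ m * q + 2 ^ (m - 1)"
        using t \<open>(2::nat) ^ m = 2 * 2 ^ (m - 1)\<close> by (simp add: algebra_simps)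
      then have "a [^] j = (a [^] ((2::nat) ^ m)) [^] q \<otimes> a [^] ((2::nat) ^ (m - 1))"
        using a(1) by (simp add: nat_pow_mult nat_pow_pow)
      then show ?thesis using j m p2 pow_ord_eq_1[OF a(1)] a(1) by simp
    qed
    moreover have "inv b \<otimes> a \<otimes> b = inv a"
    proof -
      have "inv b \<otimes> inv a \<otimes> b = a"
        using ba b a(1) by (simp add: m_assoc) (metis inv_solve_left m_closed)
      then have "inv (inv b \<otimes> inv a \<otimes> b) = inv a" by simp
      then show ?thesis using b a(1) by (simp add: inv_mult_group m_assoc)
    qed
    moreover have "carrier G = ?A \<union> (\<lambda>x. x \<otimes> b) ` ?A"
      using coset Ac b(1) by auto
    ultimately have "quaternion_generators m a b"
      using a(1) b m p2 by (simp add: quaternion_generators_def)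
    then show ?thesis using m2 p2 by blast
  qed
qed

end

section \<open>Generalized quaternion groups\<close>

context group
begin

lemma inverting_relations:
  assumes "a \<in> carrier G" "b \<in> carrier G" "inv b \<otimes> a \<otimes> b = inv a"
  shows "b \<otimes> a = inv a \<otimes> b" "b \<otimes> inv a = a \<otimes> b"
proof -
  have "b \<otimes> (inv b \<otimes> a \<otimes> b) = a \<otimes> b" using assms(1,2) by (simp flip: m_assoc)
  then show 1: "b \<otimes> inv a = a \<otimes> b" using assms by simp
  have "a \<otimes> (b \<otimes> a) = (b \<otimes> inv a) \<otimes> a" using 1 assms by (simp add: m_assoc)
  also have "\<dots> = b" using assms by (simp add: m_assoc)
  finally have "inv a \<otimes> (a \<otimes> (b \<otimes> a)) = inv a \<otimes> b" by simp
  then show "b \<otimes> a = inv a \<otimes> b" using assms by (simp flip: m_assoc)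
qed

lemma coset_union_closed:
  assumes a: "a \<in> carrier G" and b: "b \<in> carrier G" "b \<otimes> b \<in> generate G {a}" "inv b \<otimes> a \<otimes> b = inv a"
    and s: "s \<in> generate G {a} \<union> (\<lambda>x. x \<otimes> b) ` generate G {a}"
    and l: "l \<in> {a, inv a, b, inv b}"
  shows "s \<otimes> l \<in> generate G {a} \<union> (\<lambda>x. x \<otimes> b) ` generate G {a}"
proof -
  let ?A = "generate G {a}"
  have A: "\<And>u v. u \<in> ?A \<Longrightarrow> v \<in> ?A \<Longrightarrow> u \<otimes> v \<in> ?A" "\<And>u. u \<in> ?A \<Longrightarrow> inv u \<in> ?A" "a \<in> ?A"
    using generate_mult[OF a] generate_inv[OF a] generate_self by blast+
  have Ac: "\<And>u. u \<in> ?A \<Longrightarrow> u \<in> carrier G" using generate_sub[OF a] by blast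
  note ba = inverting_relations[OF a b(1,3)]
  from s show ?thesis
  proof
    assume u: "s \<in> ?A"
    have "s \<otimes> inv b = (s \<otimes> inv (b \<otimes> b)) \<otimes> b"
      using Ac[OF u] b by (simp add: inv_mult_group m_assoc)
    moreover have "s \<otimes> inv (b \<otimes> b) \<in> ?A" using A u b(2) by blast
    ultimately show ?thesis using l A u by auto
  next
    assume "s \<in> (\<lambda>x. x \<otimes> b) ` ?A"
    then obtain u where u: "u \<in> ?A" "s = u \<otimes> b" by blast
    have "s \<otimes> a = (u \<otimes> inv a) \<otimes> b" "s \<otimes> inv a = (u \<otimes> a) \<otimes> b" "s \<otimes> b = u \<otimes> (b \<otimes> b)" "s \<otimes> inv b = u"
      using u a b(1) Ac[OF u(1)] ba by (simp_all add: m_assoc)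
    moreover have "u \<otimes> inv a \<in> ?A" "u \<otimes> a \<in> ?A" "u \<otimes> (b \<otimes> b) \<in> ?A" using A u(1) b(2) by blast+
    ultimately show ?thesis using l u(1) by auto
  qed
qed

lemma coset_outside:
  assumes a: "a \<in> carrier G" and b: "b \<in> carrier G" "b \<notin> generate G {a}"
    and u: "u \<in> generate G {a}"
  shows "u \<otimes> b \<notin> generate G {a}"
proof
  assume "u \<otimes> b \<in> generate G {a}"
  then have "inv u \<otimes> (u \<otimes> b) \<in> generate G {a}" by (rule generate_mult[OF a generate_inv[OF a u]])
  moreover have "u \<in> carrier G" using u generate_sub[OF a] by blast
  ultimately show False using b by (simp flip: m_assoc)
qed

lemma quaternion_card:
  assumes q: "quaternion_generators k a b"
  shows "card (carrier G) = 2 * 2 ^ k"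
proof -
  let ?A = "generate G {a}"
  have a: "a \<in> carrier G" and b: "b \<in> carrier G" "b \<notin> ?A" and ord: "ord a = 2 ^ k"
    and car: "carrier G = ?A \<union> (\<lambda>x. x \<otimes> b) ` ?A"
    using q by (auto simp: quaternion_generators_def)
  have Ac: "?A \<subseteq> carrier G" by (rule generate_sub[OF a])
  have card: "card ?A = 2 ^ k" using generate_pow_card[OF a] ord by simp
  then have fin: "finite ?A" by (metis card.infinite power_not_zero zero_neq_numeral)
  have "inj_on (\<lambda>x. x \<otimes> b) ?A"
    using Ac b(1) right_cancel by (meson inj_onI subsetD)
  then have "card ((\<lambda>x. x \<otimes> b) ` ?A) = 2 ^ k" using card by (simp add: card_image)
  moreover have "?A \<inter> (\<lambda>x. x \<otimes> b) ` ?A = {}" using coset_outside[OF a b] by blast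
  ultimately show ?thesis using fin card by (subst car, subst card_Un_disjoint) auto
qed

end

subsection \<open>The presented group\<close>

text \<open>Right multiplication by a letter on the normal forms \<open>x^i y^j\<close>, encoded by the residue of \<open>i\<close>
  and the parity of \<open>j\<close>. Words acting in this way respect the relations, so that distinct normal
  forms stay distinct in the presented group.\<close>

fun quat_step :: "nat \<Rightarrow> quat_gen \<times> bool \<Rightarrow> int \<times> bool \<Rightarrow> int \<times> bool" where
  "quat_step k (X, neg) (i, j) = ((if neg = j then i + 1 else i - 1) mod 2 ^ k, j)"
| "quat_step k (Y, neg) (i, j) = ((if neg = j then i else i + 2 ^ (k - 1)) mod 2 ^ k, \<not> j)"

lemma quat_step_valid: "fst (quat_step k l s) \<in> {0..<2 ^ k}"
  by (cases "(k, l, s)" rule: quat_step.cases) auto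

lemma quat_steps_valid: "fst s \<in> {0..<2 ^ k} \<Longrightarrow> fst (fold (quat_step k) w s) \<in> {0..<2 ^ k}"
proof (induction w arbitrary: s)
  case (Cons l w)
  from Cons.IH[OF quat_step_valid[of k l s]] show ?case by simp
qed simp

lemma quat_steps_X:
  "i \<in> {0..<2 ^ k} \<Longrightarrow> fold (quat_step k) (replicate n (X, False)) (i, j) =
    ((if j then i - int n else i + int n) mod 2 ^ k, j)"
proof (induction n arbitrary: i)
  case (Suc n)
  have "(if j then i - 1 else i + 1) mod 2 ^ k \<in> {0..<2 ^ k}" by simp
  from Suc.IH[OF this] show ?case
    by (cases j) (simp_all add: mod_simps algebra_simps)
qed simp

lemma quat_steps_cong:
  assumes k: "1 \<le> k" and uv: "(u, v) \<in> pres_cong (quat_relations k)" and s: "fst s \<in> {0..<2 ^ k}"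
  shows "fold (quat_step k) u s = fold (quat_step k) v s"
  using uv s
proof (induction arbitrary: s rule: pres_cong.induct)
  case (append u u' v v')
  then show ?case using quat_steps_valid[of s k u'] by simp
next
  case (cancel g c)
  obtain i j where s: "s = (i, j)" by (cases s)
  have i: "i mod 2 ^ k = i" using cancel s by simp
  have two: "(2::int) ^ (k - 1) + 2 ^ (k - 1) = 2 ^ k" using k by (cases k) auto
  have "(i + 2 ^ (k - 1) + 2 ^ (k - 1)) mod 2 ^ k = i" by (simp only: add.assoc two) (simp add: i)
  then show ?case using i unfolding s by (cases g; cases c; cases j) (simp_all add: mod_simps)
next
  case (rel u v)
  obtain i j where s: "s = (i, j)" by (cases s)
  have ir: "i \<in> {0..<2 ^ k}" and i: "i mod 2 ^ k = i" using rel s by simp_all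
  have two: "(2::int) ^ (k - 1) + 2 ^ (k - 1) = 2 ^ k" using k by (cases k) auto
  have h: "(i + 2 ^ (k - 1)) mod 2 ^ k = (i - 2 ^ (k - 1)) mod 2 ^ k"
  proof -
    have "i + 2 ^ (k - 1) = i - 2 ^ (k - 1) + 2 ^ k" using two by linarith
    then show ?thesis by (metis mod_add_self2)
  qed
  have h1: "(((i + 2 ^ (k - 1)) mod 2 ^ k - 1) mod 2 ^ k + 2 ^ (k - 1)) mod 2 ^ k = (i - 1) mod 2 ^ k"
  proof -
    have "(((i + h) mod M - 1) mod M + h) mod M = (i - 1) mod M" if "h + h = M" for h M :: int
    proof -
      have "(((i + h) mod M - 1) mod M + h) mod M = (i + h - 1 + h) mod M" by (simp add: mod_simps)
      also have "i + h - 1 + h = i - 1 + M" using that by linarith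
      finally show ?thesis by simp
    qed
    from this[OF two] show ?thesis .
  qed
  from rel(1) consider "u = replicate (2 ^ k) (X, False)" "v = []"
    | "u = replicate (2 ^ (k - 1)) (X, False)" "v = [(Y, False), (Y, False)]"
    | "u = [(Y, True), (X, False), (Y, False)]" "v = [(X, True)]"
    by (auto simp: quat_relations_def)
  then show ?case
  proof cases
    case 1
    then show ?thesis using quat_steps_X[OF ir, of "2 ^ k" j] i by (simp add: s)
  next
    case 2
    then show ?thesis using quat_steps_X[OF ir, of "2 ^ (k - 1)" j] i h
      by (cases j) (simp_all add: s mod_simps)
  next
    case 3
    have "fold (quat_step k) u s = ((i - 1) mod 2 ^ k, False)" if "\<not> j"
      using that 3 by (simp add: s h1 del: One_nat_def)
    moreover have "fold (quat_step k) u s = ((i + 1) mod 2 ^ k, True)" if "j"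
      using that 3 i by (simp add: s)
    ultimately show ?thesis using 3 by (cases j) (simp_all add: s)
  qed
qed auto

lemma presented_quaternion:
  assumes k: "1 \<le> k"
  defines "R \<equiv> quat_relations k"
  shows "group.quaternion_generators (presented_group R) k (pres_cong R `` {[(X, False)]})
    (pres_cong R `` {[(Y, False)]})"
proof -
  let ?Q = "presented_group R"
  interpret Q: group ?Q by (rule group_presented_group)
  define c where "c w = pres_cong R `` {w}" for w
  define a where "a = c [(X, False)]"
  define b where "b = c [(Y, False)]"
  have mult: "c u \<otimes>\<^bsub>?Q\<^esub> c v = c (u @ v)" for u v by (simp add: c_def presented_group_mult)
  have one: "\<one>\<^bsub>?Q\<^esub> = c []" by (simp add: c_def presented_group_def)
  have mem: "c u \<in> carrier ?Q" for u by (auto simp: c_def presented_group_def quotient_def)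
  have rep: "\<exists>w. A = c w" if "A \<in> carrier ?Q" for A
    using that by (auto simp: c_def presented_group_def quotient_def)
  have eq: "c u = c v \<longleftrightarrow> (u, v) \<in> pres_cong R" for u v by (simp add: c_def pres_class_eq_iff)
  have inv: "inv\<^bsub>?Q\<^esub> (c [(g, False)]) = c [(g, True)]" for g
  proof (rule Q.inv_equality)
    show "c [(g, True)] \<otimes>\<^bsub>?Q\<^esub> c [(g, False)] = \<one>\<^bsub>?Q\<^esub>"
      using pres_cong.cancel[of g True R] by (simp add: mult one eq)
  qed (rule mem)+
  have apow: "a [^]\<^bsub>?Q\<^esub> (n::nat) = c (replicate n (X, False))" for n
  proof (induction n)
    case (Suc n)
    then show ?case by (simp add: a_def mult replicate_append_same)
  qed (simp add: one)
  have ac: "a \<in> carrier ?Q" and bc: "b \<in> carrier ?Q" by (simp_all add: a_def b_def mem)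
  have rel: "(u, v) \<in> R \<Longrightarrow> c u = c v" for u v by (simp add: eq pres_cong.rel)
  have act: "fold (quat_step k) u (0, False) = fold (quat_step k) v (0, False)" if "c u = c v" for u v
    using quat_steps_cong[OF k, of u v "(0, False)"] that by (simp add: eq R_def)
  have r1: "a [^]\<^bsub>?Q\<^esub> ((2::nat) ^ k) = \<one>\<^bsub>?Q\<^esub>"
    unfolding apow one by (rule rel) (simp add: R_def quat_relations_def)
  have r2: "b \<otimes>\<^bsub>?Q\<^esub> b = a [^]\<^bsub>?Q\<^esub> ((2::nat) ^ (k - 1))"
    unfolding apow b_def mult by (rule rel[symmetric]) (simp add: R_def quat_relations_def)
  have r3: "inv\<^bsub>?Q\<^esub> b \<otimes>\<^bsub>?Q\<^esub> a \<otimes>\<^bsub>?Q\<^esub> b = inv\<^bsub>?Q\<^esub> a"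
    unfolding a_def b_def inv mult by (rule rel) (simp add: R_def quat_relations_def)
  have "a [^]\<^bsub>?Q\<^esub> n = \<one>\<^bsub>?Q\<^esub> \<longleftrightarrow> 2 ^ k dvd n" for n :: nat
  proof
    assume "2 ^ k dvd n"
    then obtain q where "n = 2 ^ k * q" by blast
    then show "a [^]\<^bsub>?Q\<^esub> n = \<one>\<^bsub>?Q\<^esub>" using r1 ac by (simp flip: Q.nat_pow_pow)
  next
    assume "a [^]\<^bsub>?Q\<^esub> n = \<one>\<^bsub>?Q\<^esub>"
    then have "int n mod 2 ^ k = 0"
      using act[of "replicate n (X, False)" "[]"] quat_steps_X[of 0 k n False] by (simp add: apow one)
    then have "int (2 ^ k) dvd int n" by (simp add: mod_eq_0_iff_dvd)
    then show "2 ^ k dvd n" by (simp only: int_dvd_int_iff)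
  qed
  then have ord: "Q.ord a = 2 ^ k" using Q.ord_unique[OF ac] by blast
  have "b \<notin> generate ?Q {a}"
  proof
    assume "b \<in> generate ?Q {a}"
    then obtain n :: nat where "b = a [^]\<^bsub>?Q\<^esub> n" using Q.generate_pow_nat[OF ac] ord by auto
    then have "snd (fold (quat_step k) [(Y, False)] (0, False)) = False"
      using act[of "[(Y, False)]" "replicate n (X, False)"] quat_steps_X[of 0 k n False]
      by (simp add: apow b_def)
    then show False by simp
  qed
  moreover have "carrier ?Q = generate ?Q {a} \<union> (\<lambda>x. x \<otimes>\<^bsub>?Q\<^esub> b) ` generate ?Q {a}" (is "_ = ?S")
  proof
    have b2: "b \<otimes>\<^bsub>?Q\<^esub> b \<in> generate ?Q {a}" using r2 Q.generate_pow_in[OF ac] by simp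
    have "c w \<in> ?S" for w
    proof (induction w rule: rev_induct)
      case Nil
      then show ?case using generate.one[of ?Q "{a}"] by (simp add: one)
    next
      case (snoc l w)
      obtain g i where l: "l = (g, i)" by (cases l)
      have "c [l] \<in> {a, inv\<^bsub>?Q\<^esub> a, b, inv\<^bsub>?Q\<^esub> b}"
        unfolding l by (cases g; cases i) (auto simp: a_def b_def inv)
      then have "c w \<otimes>\<^bsub>?Q\<^esub> c [l] \<in> ?S" by (rule Q.coset_union_closed[OF ac bc b2 r3 snoc])
      then show ?case by (simp add: mult)
    qed
    then show "carrier ?Q \<subseteq> ?S" using rep by fast
    show "?S \<subseteq> carrier ?Q" using Q.generate_sub[OF ac] bc by auto
  qed
  ultimately show ?thesis
    using ac bc ord r2 r3 unfolding Q.quaternion_generators_def a_def b_def c_def by blast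
qed

text \<open>Evaluating words maps the presented group onto any group with such generators; both have the
  same finite order.\<close>

lemma (in group) presented_quaternion_iso:
  assumes k: "1 \<le> k" and q: "quaternion_generators k a b"
  shows "G \<cong> presented_group (quat_relations k)"
proof -
  let ?R = "quat_relations k"
  let ?Q = "presented_group ?R"
  interpret Q: group ?Q by (rule group_presented_group)
  have a: "a \<in> carrier G" and b: "b \<in> carrier G" and ord: "ord a = 2 ^ k"
    and bb: "b \<otimes> b = a [^] ((2::nat) ^ (k - 1))" and ba: "inv b \<otimes> a \<otimes> b = inv a"
    and car: "carrier G = generate G {a} \<union> (\<lambda>x. x \<otimes> b) ` generate G {a}"
    using q by (auto simp: quaternion_generators_def)
  define gen where "gen g = (case g of X \<Rightarrow> a | Y \<Rightarrow> b)" for g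
  define letter where "letter l = (if snd l then inv (gen (fst l)) else gen (fst l))" for l
  define ev where "ev w = foldr (\<lambda>l x. letter l \<otimes> x) w \<one>" for w
  have genc: "gen g \<in> carrier G" for g using a b by (cases g) (auto simp: gen_def)
  have lc: "letter l \<in> carrier G" for l using genc by (simp add: letter_def)
  have ev_Nil: "ev [] = \<one>" and ev_Cons: "ev (l # w) = letter l \<otimes> ev w" for l w
    by (simp_all add: ev_def)
  have evc: "ev w \<in> carrier G" for w by (induction w) (simp_all add: ev_Nil ev_Cons lc)
  have ev_app: "ev (u @ v) = ev u \<otimes> ev v" for u v
    by (induction u) (simp_all add: ev_Nil ev_Cons lc evc m_assoc)
  have ev_rep: "ev (replicate n (X, False)) = a [^] n" for n
  proof (induction n)
    case (Suc n)
    have "ev (replicate (Suc n) (X, False)) = a \<otimes> a [^] n"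
      using Suc by (simp add: ev_Cons letter_def gen_def)
    then show ?case using nat_pow_Suc2[OF a] by simp
  qed (simp add: ev_Nil)
  have ev_cong: "ev u = ev v" if "(u, v) \<in> pres_cong ?R" for u v
    using that
  proof (induction rule: pres_cong.induct)
    case (cancel g i)
    then show ?case using genc[of g] by (cases i) (simp_all add: ev_Cons ev_Nil letter_def)
  next
    case (rel u v)
    then consider "u = replicate (2 ^ k) (X, False)" "v = []"
      | "u = replicate (2 ^ (k - 1)) (X, False)" "v = [(Y, False), (Y, False)]"
      | "u = [(Y, True), (X, False), (Y, False)]" "v = [(X, True)]"
      by (auto simp: quat_relations_def)
    then show ?case
    proof cases
      case 1
      then show ?thesis using pow_ord_eq_1[OF a] ord by (simp add: ev_rep ev_Nil)
    next
      case 2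
      then show ?thesis using bb b by (simp add: ev_rep ev_Cons ev_Nil letter_def gen_def)
    next
      case 3
      then show ?thesis using ba a b by (simp add: ev_Cons ev_Nil letter_def gen_def m_assoc)
    qed
  qed (simp_all add: ev_app)
  define \<phi> where "\<phi> A = ev (SOME w. w \<in> A)" for A
  have \<phi>: "\<phi> (pres_cong ?R `` {w}) = ev w" for w
  proof -
    have "w \<in> pres_cong ?R `` {w}" by (simp add: pres_cong.refl)
    then have "(SOME w'. w' \<in> pres_cong ?R `` {w}) \<in> pres_cong ?R `` {w}" by (rule someI)
    then show ?thesis using ev_cong unfolding \<phi>_def by fastforce
  qed
  have rep: "\<exists>w. A = pres_cong ?R `` {w}" if "A \<in> carrier ?Q" for A
    using that by (auto simp: presented_group_def quotient_def)
  have mem: "pres_cong ?R `` {w} \<in> carrier ?Q" for w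
    by (auto simp: presented_group_def quotient_def)
  have hom: "\<phi> \<in> hom ?Q G"
  proof (rule homI)
    fix A assume "A \<in> carrier ?Q"
    then obtain u where u: "A = pres_cong ?R `` {u}" using rep by blast
    show "\<phi> A \<in> carrier G" unfolding u \<phi> by (rule evc)
    fix B assume "B \<in> carrier ?Q"
    then obtain v where v: "B = pres_cong ?R `` {v}" using rep by blast
    show "\<phi> (A \<otimes>\<^bsub>?Q\<^esub> B) = \<phi> A \<otimes> \<phi> B" unfolding u v presented_group_mult \<phi> by (rule ev_app)
  qed
  have surj: "\<phi> ` carrier ?Q = carrier G"
  proof
    show "\<phi> ` carrier ?Q \<subseteq> carrier G" using hom by (auto simp: hom_def)
    show "carrier G \<subseteq> \<phi> ` carrier ?Q"
    proof
      fix x assume "x \<in> carrier G"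
      then consider n :: nat where "x = a [^] n" | n :: nat where "x = a [^] n \<otimes> b"
        unfolding car using generate_pow_nat[OF a] ord by auto
      then obtain w where "x = ev w"
      proof cases
        case 1
        then show ?thesis using that[of "replicate n (X, False)"] by (simp add: ev_rep)
      next
        case 2
        then show ?thesis using that[of "replicate n (X, False) @ [(Y, False)]"] b
          by (simp add: ev_app ev_rep ev_Cons ev_Nil letter_def gen_def)
      qed
      then show "x \<in> \<phi> ` carrier ?Q" using \<phi>[of w] mem by (metis image_eqI)
    qed
  qed
  have "card (carrier ?Q) = 2 * 2 ^ k" using Q.quaternion_card presented_quaternion[OF k] by blast
  moreover from this have "finite (carrier ?Q)" by (intro card_ge_0_finite) simp
  ultimately have "inj_on \<phi> (carrier ?Q)"
    using quaternion_card[OF q] surj by (intro eq_card_imp_inj_on) auto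
  then have "\<phi> \<in> iso ?Q G" using hom surj by (simp add: iso_iff)
  then have "?Q \<cong> G" by (rule is_isoI)
  then show ?thesis by (rule Q.iso_sym)
qed

lemma (in group) quaternion_generators_transfer:
  assumes H: "group H" and h: "h \<in> iso H G" and q: "group.quaternion_generators H k a b"
  shows "quaternion_generators k (h a) (h b)"
proof -
  interpret H: group H by (rule H)
  have hom: "h \<in> hom H G" and bij: "bij_betw h (carrier H) (carrier G)" using h by (auto simp: iso_def)
  interpret gh: group_hom H G h by unfold_locales (rule hom)
  have a: "a \<in> carrier H" and b: "b \<in> carrier H" "b \<notin> generate H {a}" and ord: "H.ord a = 2 ^ k"
    and bb: "b \<otimes>\<^bsub>H\<^esub> b = a [^]\<^bsub>H\<^esub> ((2::nat) ^ (k - 1))"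
    and ba: "inv\<^bsub>H\<^esub> b \<otimes>\<^bsub>H\<^esub> a \<otimes>\<^bsub>H\<^esub> b = inv\<^bsub>H\<^esub> a"
    and car: "carrier H = generate H {a} \<union> (\<lambda>x. x \<otimes>\<^bsub>H\<^esub> b) ` generate H {a}"
    using q by (auto simp: H.quaternion_generators_def)
  have inj: "inj_on h (carrier H)" and img: "h ` carrier H = carrier G"
    using bij by (auto simp: bij_betw_def)
  have gen: "generate G {h a} = h ` generate H {a}" using gh.generate_img[of "{a}"] a by simp
  have Ac: "generate H {a} \<subseteq> carrier H" by (rule H.generate_sub[OF a])
  have "ord (h a) = card (generate G {h a})" using generate_pow_card[of "h a"] a by simp
  also have "\<dots> = card (generate H {a})" unfolding gen
    using inj Ac by (intro card_image) (rule inj_on_subset)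
  finally have "ord (h a) = 2 ^ k" using H.generate_pow_card[OF a] ord by simp
  moreover have "h b \<notin> generate G {h a}"
    unfolding gen using inj_on_image_mem_iff[OF inj b(1) Ac] b(2) by simp
  moreover have "h b \<otimes> h b = h a [^] ((2::nat) ^ (k - 1))"
  proof -
    have "h b \<otimes> h b = h (a [^]\<^bsub>H\<^esub> ((2::nat) ^ (k - 1)))" using bb b(1) by (metis gh.hom_mult)
    also have "\<dots> = h a [^] ((2::nat) ^ (k - 1))" using gh.hom_nat_pow[OF a] by simp
    finally show ?thesis .
  qed
  moreover have "inv (h b) \<otimes> h a \<otimes> h b = inv (h a)"
    using arg_cong[OF ba, of h] a b(1) by simp
  moreover have "carrier G = generate G {h a} \<union> (\<lambda>x. x \<otimes> h b) ` generate G {h a}"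
  proof -
    have "h ` (\<lambda>x. x \<otimes>\<^bsub>H\<^esub> b) ` generate H {a} = (\<lambda>x. x \<otimes> h b) ` h ` generate H {a}"
      using Ac b(1) by (auto simp: image_image intro!: image_cong)
    then show ?thesis unfolding gen by (metis img car image_Un)
  qed
  moreover have "h a \<in> carrier G" "h b \<in> carrier G" using a b(1) by simp_all
  ultimately show ?thesis unfolding quaternion_generators_def by blast
qed

theorem (in group) generalized_quaternion_iff:
  "generalized_quaternion G \<longleftrightarrow> (\<exists>k\<ge>2. \<exists>a b. quaternion_generators k a b)"
proof
  assume "generalized_quaternion G"
  then obtain k where k: "2 \<le> k" "G \<cong> presented_group (quat_relations k)"
    by (auto simp: generalized_quaternion_def)
  then obtain h where "h \<in> iso (presented_group (quat_relations k)) G"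
    using iso_sym by (auto simp: is_iso_def)
  then show "\<exists>k\<ge>2. \<exists>a b. quaternion_generators k a b"
    using quaternion_generators_transfer[OF group_presented_group _ presented_quaternion[of k]] k(1)
    by (meson le_trans one_le_numeral)
next
  assume "\<exists>k\<ge>2. \<exists>a b. quaternion_generators k a b"
  then show "generalized_quaternion G"
    using presented_quaternion_iso is_group unfolding generalized_quaternion_def
    by (meson le_trans one_le_numeral)
qed

subsection \<open>The power graph of a generalized quaternion group\<close>

context group
begin

lemma quaternion_conj:
  assumes q: "quaternion_generators k a b" and fin: "finite (carrier G)" and u: "u \<in> generate G {a}"
  shows "b \<otimes> u = inv u \<otimes> b"
proof -
  have a: "a \<in> carrier G" and b: "b \<in> carrier G" and ba: "inv b \<otimes> a \<otimes> b = inv a"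
    using q by (auto simp: quaternion_generators_def)
  obtain i :: nat where i: "u = a [^] i" using u generate_eq_nat_pows[OF fin a] by auto
  have "b \<otimes> a \<otimes> inv b = inv a"
    using inverting_relations(1)[OF a b ba] a b by (simp add: m_assoc)
  then have "b \<otimes> u \<otimes> inv b = inv u"
    using conj_nat_pow[OF b a, of i] a i by (simp add: nat_pow_inv)
  then have "(b \<otimes> u \<otimes> inv b) \<otimes> b = inv u \<otimes> b" by simp
  then show ?thesis using a b i by (simp add: m_assoc)
qed

text \<open>Every element \<open>u b\<close> outside \<open>\<langle>a\<rangle>\<close> squares to the involution \<open>b\<^sup>2\<close>, hence has order \<open>4\<close>.\<close>

lemma quaternion_coset_square:
  assumes q: "quaternion_generators k a b" and fin: "finite (carrier G)" and u: "u \<in> generate G {a}"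
  shows "(u \<otimes> b) \<otimes> (u \<otimes> b) = b \<otimes> b"
proof -
  have a: "a \<in> carrier G" and b: "b \<in> carrier G"
    using q by (auto simp: quaternion_generators_def)
  have uc: "u \<in> carrier G" using u generate_sub[OF a] by blast
  have "(u \<otimes> b) \<otimes> (u \<otimes> b) = u \<otimes> (b \<otimes> u) \<otimes> b" using uc b by (simp add: m_assoc)
  also have "\<dots> = u \<otimes> (inv u \<otimes> b) \<otimes> b" using quaternion_conj[OF q fin u] by simp
  also have "\<dots> = b \<otimes> b" using uc b by (simp flip: m_assoc)
  finally show ?thesis .
qed

lemma order_4_powers:
  assumes y: "y \<in> carrier G" and z: "y \<otimes> y = z" "z \<otimes> z = \<one>"
  shows "y [^] (n::nat) \<in> {\<one>, z, y, z \<otimes> y}"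
proof (induction n)
  case (Suc n)
  have zc: "z \<in> carrier G" using y z(1) by auto
  from Suc consider "y [^] n = \<one>" | "y [^] n = z" | "y [^] n = y" | "y [^] n = z \<otimes> y" by blast
  then show ?case
    by cases (use y zc z in \<open>simp_all add: m_assoc\<close>)
qed simp

end

text \<open>The involution \<open>b^2\<close> is a power of every nontrivial element, and a cyclic subgroup generated
  outside \<open>\<langle>a\<rangle>\<close> has order \<open>4\<close> and meets \<open>\<langle>a\<rangle>\<close> in \<open>{1, b^2}\<close>. So in the coset of \<open>b\<close> only \<open>y\<close> and
  \<open>b^2 y\<close> are adjacent, and \<open>a^i b\<close>, \<open>a^(i+1) b\<close> are not of this form because \<open>a\<close> has order at least \<open>4\<close>.\<close>

lemma (in prime_power_group) quaternion_comparable: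
  assumes q: "quaternion_generators k a b" and k: "2 \<le> k" and p2: "p = 2"
  defines "z \<equiv> b \<otimes> b"
  shows "z \<in> generate G {a}" "z \<noteq> \<one>"
    and "\<And>x. x \<in> carrier G \<Longrightarrow> comparable z x"
    and "\<And>u v. u \<in> generate G {a} \<Longrightarrow> v \<in> generate G {a} \<Longrightarrow> u \<notin> {\<one>, z} \<Longrightarrow> \<not> comparable u (v \<otimes> b)"
    and "\<And>i. \<not> comparable (a [^] (i::nat) \<otimes> b) (a [^] Suc i \<otimes> b)"
proof -
  let ?A = "generate G {a}"
  have a: "a \<in> carrier G" and b: "b \<in> carrier G" "b \<notin> ?A" and ord: "ord a = 2 ^ k"
    and bb: "z = a [^] ((2::nat) ^ (k - 1))"
    and car: "carrier G = ?A \<union> (\<lambda>x. x \<otimes> b) ` ?A"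
    using q by (auto simp: quaternion_generators_def z_def)
  have Ac: "?A \<subseteq> carrier G" by (rule generate_sub[OF a])
  show zA: "z \<in> ?A" using bb generate_pow_in[OF a] by simp
  have zc: "z \<in> carrier G" using zA Ac by blast
  have two: "(2::nat) ^ k = 2 * 2 ^ (k - 1)" using k by (cases k) auto
  have ordz: "ord z = 2" using ord_pow[OF a, of "2 ^ (k - 1)"] ord two bb by simp
  then show z1: "z \<noteq> \<one>" using ord_eq_1[OF zc] by auto
  have zz: "z \<otimes> z = \<one>"
    using pow_ord_eq_1[OF zc] ordz zc by (simp add: numeral_2_eq_2)
  have sq: "(u \<otimes> b) \<otimes> (u \<otimes> b) = z" if "u \<in> ?A" for u
    using quaternion_coset_square[OF q fin that] by (simp add: z_def)
  note notin = coset_outside[OF a b]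
  have coset_pows: "x \<in> {\<one>, z, u \<otimes> b, z \<otimes> (u \<otimes> b)}"
    if x: "x \<in> generate G {u \<otimes> b}" and u: "u \<in> ?A" for x u
  proof -
    have c: "u \<otimes> b \<in> carrier G" using u Ac b(1) by blast
    obtain n :: nat where "x = (u \<otimes> b) [^] n" using x generate_eq_nat_pows[OF fin c] by auto
    then show ?thesis using order_4_powers[OF c sq[OF u] zz] by simp
  qed
  show "comparable z x" if x: "x \<in> carrier G" for x
  proof (cases "x \<in> ?A")
    case True
    then have "x = \<one> \<or> z \<in> generate G {x}"
      using order_p_below[OF a zc _ zA True] ordz p2 by blast
    then show ?thesis using generate.one[of G "{z}"] by (auto simp: comparable_def)
  next
    case False
    then obtain u where u: "u \<in> ?A" "x = u \<otimes> b" using x car by blast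
    then have "z \<in> generate G {x}" using generate_mult[OF x generate_self generate_self] sq by metis
    then show ?thesis by (simp add: comparable_def)
  qed
  show "\<not> comparable u (v \<otimes> b)" if u: "u \<in> ?A" "u \<notin> {\<one>, z}" and v: "v \<in> ?A" for u v
  proof
    assume "comparable u (v \<otimes> b)"
    then show False
      unfolding comparable_def
    proof
      assume "u \<in> generate G {v \<otimes> b}"
      then have "u = v \<otimes> b \<or> u = z \<otimes> (v \<otimes> b)" using coset_pows[OF _ v] u(2) by blast
      moreover have "z \<otimes> (v \<otimes> b) = (z \<otimes> v) \<otimes> b"
        using m_assoc[OF zc _ b(1), of v] v Ac by auto
      moreover have "z \<otimes> v \<in> ?A" by (rule generate_mult[OF a zA v])
      ultimately show False using notin v u(1) by metis
    next
      assume "v \<otimes> b \<in> generate G {u}"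
      then show False using generate_trans[OF a _ u(1)] notin[OF v] by blast
    qed
  qed
  have same: "u = v \<or> u = z \<otimes> v" if x: "u \<otimes> b \<in> generate G {v \<otimes> b}" and uv: "u \<in> ?A" "v \<in> ?A" for u v
  proof -
    have c: "u \<in> carrier G" "v \<in> carrier G" using uv Ac by auto
    have "u \<otimes> b \<noteq> \<one>" "u \<otimes> b \<noteq> z" using notin[OF uv(1)] zA generate.one[of G "{a}"] by auto
    then have "u \<otimes> b = v \<otimes> b \<or> u \<otimes> b = (z \<otimes> v) \<otimes> b"
      using coset_pows[OF x uv(2)] m_assoc[OF zc c(2) b(1)] by auto
    then show ?thesis using c zc b(1) right_cancel by (meson m_closed)
  qed
  show "\<not> comparable (a [^] i \<otimes> b) (a [^] Suc i \<otimes> b)" for i :: nat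
  proof
    have in_A: "a [^] n \<in> ?A" for n :: nat by (rule generate_pow_in[OF a])
    have le: "(2::nat) ^ 2 \<le> 2 ^ k" using k by (intro power_increasing) auto
    assume "comparable (a [^] i \<otimes> b) (a [^] Suc i \<otimes> b)"
    then have "a [^] i = a [^] Suc i \<or> a [^] i = z \<otimes> a [^] Suc i \<or> a [^] Suc i = z \<otimes> a [^] i"
      using same[OF _ in_A[of i] in_A[of "Suc i"]] same[OF _ in_A[of "Suc i"] in_A[of i]]
      unfolding comparable_def by metis
    moreover have shift: "z \<otimes> a [^] n = a [^] (2 ^ (k - 1) + n)" for n :: nat
      using a by (simp add: bb nat_pow_mult)
    ultimately have "a [^] i = a [^] Suc i \<or> a [^] i = a [^] (2 ^ (k - 1) + Suc i)
        \<or> a [^] Suc i = a [^] (2 ^ (k - 1) + i)"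
      by (simp only: shift)
    moreover have eq: "a [^] m = a [^] n \<longleftrightarrow> int (2 ^ k) dvd int n - int m" for m n :: nat
      using int_pow_eq[OF a, of "int m" "int n"] ord by (simp add: int_pow_int)
    ultimately have "int (2 ^ k) dvd 1 \<or> int (2 ^ k) dvd 2 ^ (k - 1) + 1 \<or> int (2 ^ k) dvd 2 ^ (k - 1) - 1"
      unfolding eq by (simp add: add.commute)
    moreover have "even x" if "int (2 ^ k) dvd x" for x
    proof -
      have "2 dvd int (2 ^ k)" using k by simp
      then show ?thesis using that by (rule dvd_trans)
    qed
    ultimately have "even (1::int) \<or> even ((2::int) ^ (k - 1) + 1) \<or> even ((2::int) ^ (k - 1) - 1)"
      by blast
    moreover have "even ((2::int) ^ (k - 1))" using k by simp
    ultimately show False by simp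
  qed
qed

text \<open>The coset of \<open>b\<close> is traversed as \<open>b, a b, a^2 b, \<dots>\<close>; the elements of \<open>\<langle>a\<rangle>\<close> that remain are
  adjacent to none of these and fewer in number, and are inserted in between.\<close>

theorem (in prime_power_group) quaternion_hamiltonian_path:
  assumes q: "quaternion_generators k a b" and k: "2 \<le> k" and p2: "p = 2"
  shows "\<exists>xs. distinct xs \<and> set xs = carrier G - {\<one>, b \<otimes> b} \<and>
    successively (\<lambda>a b. \<not> comparable a b) xs"
proof -
  let ?A = "generate G {a}" and ?z = "b \<otimes> b"
  have a: "a \<in> carrier G" and b: "b \<in> carrier G" "b \<notin> ?A" and ord: "ord a = 2 ^ k"
    and car: "carrier G = ?A \<union> (\<lambda>x. x \<otimes> b) ` ?A"
    using q by (auto simp: quaternion_generators_def)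
  have Ac: "?A \<subseteq> carrier G" by (rule generate_sub[OF a])
  have finA: "finite ?A" using Ac fin finite_subset by blast
  note cmp = quaternion_comparable[OF q k p2]
  have pows: "?A = (\<lambda>i. a [^] i) ` {..<(2::nat) ^ k}"
  proof -
    have "0 < ord a" by (simp add: ord)
    then have "{0..ord a - 1} = {..<ord a}" by auto
    moreover have "?A = {a [^] i |i. i \<in> {0..ord a - 1}}"
      using generate_pow_on_finite_carrier[OF fin a] ord_elems[OF fin a] by simp
    ultimately show ?thesis by (auto simp: ord)
  qed
  have "inj_on (\<lambda>i. a [^] i) {..<(2::nat) ^ k}"
  proof (rule eq_card_imp_inj_on)
    show "card ((\<lambda>i. a [^] i) ` {..<(2::nat) ^ k}) = card {..<(2::nat) ^ k}"
      using generate_pow_card[OF a] ord pows by simp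
  qed simp
  moreover have "inj_on (\<lambda>x. x \<otimes> b) ?A"
    using Ac b(1) right_cancel by (meson inj_onI subsetD)
  ultimately have inj: "inj_on (\<lambda>i. a [^] i \<otimes> b) {..<(2::nat) ^ k}"
    unfolding pows using comp_inj_on[of "\<lambda>i. a [^] i" "{..<(2::nat) ^ k}" "\<lambda>x. x \<otimes> b"]
    by (simp add: o_def)
  define ys where "ys = map (\<lambda>i. a [^] i \<otimes> b) [0..<2 ^ k]"
  have ys: "distinct ys" "set ys = (\<lambda>x. x \<otimes> b) ` ?A"
    using inj by (auto simp: ys_def distinct_map pows atLeast0LessThan)
  have path: "successively (\<lambda>a b. \<not> comparable a b) ys"
    using cmp(5) by (auto simp: successively_conv_nth ys_def simp del: nat_pow_Suc)
  obtain xs where xs: "distinct xs" "set xs = ?A - {\<one>, ?z}"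
    using finite_distinct_list[of "?A - {\<one>, ?z}"] finA by auto
  have "length xs \<le> length ys"
  proof -
    have "length xs \<le> card ?A" using distinct_card[OF xs(1)] xs(2) finA by (metis Diff_subset card_mono)
    then show ?thesis using generate_pow_card[OF a] ord by (simp add: ys_def)
  qed
  moreover have "\<not> comparable x y \<and> \<not> comparable y x" if "x \<in> set xs" "y \<in> set ys" for x y
    using that cmp(4)[of x] comparable_sym unfolding xs(2) ys(2) by blast
  ultimately have "successively (\<lambda>a b. \<not> comparable a b) (splice ys xs)"
    using successively_splice[OF path, of xs] by blast
  note disj = coset_outside[OF a b]
  have "set ys \<inter> set xs = {}" using xs ys disj by auto
  then have "distinct (splice ys xs)"
    using distinct_disjoint_shuffles[OF ys(1) xs(1) _ splice_in_shuffles] by blast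
  moreover have "set (splice ys xs) = carrier G - {\<one>, ?z}"
    using set_shuffles[OF splice_in_shuffles[of ys xs]] xs ys car disj cmp(1) generate.one[of G "{a}"]
    by auto
  ultimately show ?thesis using \<open>successively _ (splice ys xs)\<close> by blast
qed

section \<open>The lambda number of the power graph\<close>

lemma (in prime_power_group) power_graph_arcs:
  "(a, b) \<in> parcs (power_graph G) \<longleftrightarrow> a \<in> carrier G \<and> b \<in> carrier G \<and> a \<noteq> b \<and> comparable a b"
proof -
  have *: "(\<exists>n::nat. n > 0 \<and> x = y [^] n) \<longleftrightarrow> x \<in> generate G {y}" if y: "y \<in> carrier G" for x y
  proof
    assume "x \<in> generate G {y}"
    then obtain n :: nat where n: "x = y [^] n" using generate_eq_nat_pows[OF fin y] by auto
    have "x = y [^] (n + ord y)" using n y by (simp flip: nat_pow_mult)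
    moreover have "n + ord y > 0" using ord_ge_1[OF fin y] by simp
    ultimately show "\<exists>n::nat. n > 0 \<and> x = y [^] n" by blast
  qed (use generate_pow_in[OF y] in blast)
  have "(a, b) \<in> parcs (power_graph G) \<longleftrightarrow> a \<in> carrier G \<and> b \<in> carrier G \<and> a \<noteq> b \<and>
      ((\<exists>n::nat. n > 0 \<and> a = b [^] n) \<or> (\<exists>n::nat. n > 0 \<and> b = a [^] n))"
    by (simp add: power_graph_def)
  then show ?thesis unfolding comparable_def using *[of b a] *[of a b] by blast
qed

context prime_power_group
begin

lemma power_graph_pair_graph: "pair_graph (power_graph G)"
  by (rule pair_graph_power_graph[OF fin])

lemma power_graph_verts: "pverts (power_graph G) = carrier G"
  by (simp add: power_graph_def)

lemma power_graph_one:
  "\<one> \<in> pverts (power_graph G)"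
  "v \<in> pverts (power_graph G) \<Longrightarrow> v \<noteq> \<one> \<Longrightarrow> (\<one>, v) \<in> parcs (power_graph G)"
  by (auto simp: power_graph_verts power_graph_arcs comparable_def generate.one)

lemma power_graph_path:
  assumes "successively (\<lambda>a b. \<not> comparable a b) xs"
  shows "successively (\<lambda>a b. (a, b) \<notin> parcs (power_graph G) \<and> (b, a) \<notin> parcs (power_graph G)) xs"
  using assms by (rule successively_mono) (auto simp: power_graph_arcs comparable_def)

lemma cyclic_group_iff: "cyclic_group G \<longleftrightarrow> (\<exists>x\<in>carrier G. carrier G = generate G {x})"
  unfolding cyclic_group by (intro bex_cong) (auto simp: generate_pow)

theorem lambda_number_cyclic:
  assumes "cyclic_group G"
  shows "lambda_number (with_proj (power_graph G)) = 2 * (int (group_exponent G) - 1)"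
proof -
  obtain x where x: "x \<in> carrier G" "carrier G = generate G {x}"
    using assms cyclic_group_iff by blast
  have "ord x = order G" using generate_pow_card[OF x(1)] x(2) by (simp add: order_def)
  then have "group_exponent G = order G"
    unfolding group_exponent_def
    using ord_le_group_order[OF fin] imageI[OF x(1), of ord] fin by (intro Max_eqI) auto
  moreover have "lambda_number (with_proj (power_graph G))
      = 2 * (int (card (pverts (power_graph G))) - 1)"
  proof (rule lambda_number_complete[OF power_graph_pair_graph])
    show "pverts (power_graph G) \<noteq> {}" using power_graph_one(1) by blast
    show "(u, v) \<in> parcs (power_graph G)"
      if "u \<in> pverts (power_graph G)" "v \<in> pverts (power_graph G)" "u \<noteq> v" for u v
      using that cyclic_chain[OF x(1), of u v] x(2)
      unfolding power_graph_verts power_graph_arcs comparable_def by blast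
  qed
  ultimately show ?thesis by (simp add: power_graph_verts order_def)
qed

theorem lambda_number_quaternion:
  assumes "p = 2" "generalized_quaternion G"
  shows "lambda_number (with_proj (power_graph G)) = int (order G) + 1"
proof -
  let ?P = "power_graph G"
  obtain k a b where k: "2 \<le> k" and q: "quaternion_generators k a b"
    using assms(2) generalized_quaternion_iff by blast
  have b: "b \<in> carrier G" using q unfolding quaternion_generators_def by blast
  note cmp = quaternion_comparable[OF q k assms(1)]
  obtain xs where xs: "distinct xs" "set xs = carrier G - {\<one>, b \<otimes> b}"
      "successively (\<lambda>a b. \<not> comparable a b) xs"
    using quaternion_hamiltonian_path[OF q k assms(1)] by blast
  have "xs \<noteq> []"
  proof
    assume "xs = []"
    then have "carrier G \<subseteq> {\<one>, b \<otimes> b}" using xs(2) by auto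
    then have "card (carrier G) \<le> card {\<one>, b \<otimes> b}" by (intro card_mono) auto
    also have "\<dots> \<le> 2" by (simp add: card_insert_if)
    also have "(2::nat) < 2 * 2 ^ k" using k one_less_power[of "2::nat" k] by simp
    finally show False using quaternion_card[OF q] by simp
  qed
  moreover have "b \<otimes> b \<in> pverts ?P" "\<one> \<noteq> b \<otimes> b" using b cmp(2) by (auto simp: power_graph_verts)
  moreover have "(b \<otimes> b, v) \<in> parcs ?P" if "v \<in> pverts ?P" "v \<noteq> b \<otimes> b" for v
    using that cmp(3) b by (auto simp: power_graph_verts power_graph_arcs)
  ultimately have "lambda_number (with_proj ?P) = int (card (pverts ?P)) + 1"
    using xs(1,2) power_graph_path[OF xs(3)]
    by (intro lambda_number_two_universal[OF power_graph_pair_graph power_graph_one, of "b \<otimes> b" xs])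
      (simp_all add: power_graph_verts)
  then show ?thesis by (simp add: power_graph_verts order_def)
qed

theorem lambda_number_otherwise:
  assumes "\<not> cyclic_group G" "\<not> (p = 2 \<and> generalized_quaternion G)"
  shows "lambda_number (with_proj (power_graph G)) = int (order G)"
proof -
  let ?P = "power_graph G"
  have "\<not> ((\<exists>a\<in>carrier G. carrier G = generate G {a}) \<or>
      (p = 2 \<and> (\<exists>k\<ge>2. \<exists>a b. quaternion_generators k a b)))"
    using assms cyclic_group_iff generalized_quaternion_iff by blast
  then obtain s t where st: "s \<in> carrier G" "ord s = p" "t \<in> carrier G" "ord t = p"
      "t \<notin> generate G {s}"
    using unique_subgroup_order_p by blast
  obtain xs where xs: "distinct xs" "set xs = carrier G - {\<one>}"
      "successively (\<lambda>a b. \<not> comparable a b) xs"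
    using hamiltonian_path_two_subgroups[OF st] by blast
  have "t \<noteq> \<one>" using st(5) generate.one[of G "{s}"] by auto
  then have "t \<in> set xs" using xs(2) st(3) by simp
  then have "xs \<noteq> []" by (cases xs) simp_all
  then have "lambda_number (with_proj ?P) = int (card (pverts ?P))"
    using xs(1,2) power_graph_path[OF xs(3)]
    by (intro lambda_number_one_universal[OF power_graph_pair_graph power_graph_one, of xs])
      (simp_all add: power_graph_verts)
  then show ?thesis by (simp add: power_graph_verts order_def)
qed

end

theorem mainTheorem2:
  fixes G :: "('a, 'b) monoid_scheme" and p e :: nat
  assumes "prime p"
    and "p_group p G"
    and "group_exponent G = p ^ e"
  shows "(cyclic_group G \<longrightarrow>
           lambda_number (with_proj (power_graph G)) = 2 * (int p ^ e - 1)) \<and>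
         (p = 2 \<and> generalized_quaternion G \<longrightarrow>
           lambda_number (with_proj (power_graph G)) = int (order G) + 1) \<and>
         (\<not> cyclic_group G \<and> \<not> (p = 2 \<and> generalized_quaternion G) \<longrightarrow>
           lambda_number (with_proj (power_graph G)) = int (order G))"
proof -
  have "prime_power_group G p"
    using assms(2) by (auto simp: p_group_def prime_power_group_def prime_power_group_axioms_def)
  note main = prime_power_group.lambda_number_cyclic[OF this]
    prime_power_group.lambda_number_quaternion[OF this]
    prime_power_group.lambda_number_otherwise[OF this]
  have "int (group_exponent G) = int p ^ e" using assms(3) by simp
  then show ?thesis
  proof (intro conjI impI)
    assume "cyclic_group G"
    from main(1)[OF this] show "lambda_number (with_proj (power_graph G)) = 2 * (int p ^ e - 1)"
      unfolding \<open>int (group_exponent G) = int p ^ e\<close> .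
  qed (elim conjE, rule main; assumption)+
qed

end
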